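(* (Predicative cut elimination) Let $\alpha,\beta,\rho\prec\Omega$, $X\subseteq\vartheta(\varepsilon_{\Omega+1})$, and let $\eta$ be a term with $\Omega^2\preceq\eta$ and $\alpha\in\mathcal H_\eta(X)$. For every sequent $\Gamma$: if $\mathcal H_\eta[X]\vdash^\beta_{\rho+\omega(\alpha)}\Gamma$, then $\mathcal H_\eta[X]\vdash^{\overline\varphi(\alpha,\beta)}_\rho\Gamma$, where $\overline\varphi(\alpha,\beta):=\vartheta(\Omega\cdot\alpha+\beta)$.
   Context: Ordinal terms: The set $\vartheta(\varepsilon_{\Omega+1})$ of terms, a relation $\prec$ and finite sets $E(\alpha)$ are defined by simultaneous recursion on term length: Terms: $\Omega$; $\vartheta\alpha$ for each term $\alpha$; $\langle\alpha_0,\dots,\alpha_{n-1}\rangle$ ($n\ge0$) provided that if $n>1$ then $\alpha_{n-1}\preceq\dots\preceq\alpha_0$ ($\preceq$ is $\prec$ or syntactic equality), and if $n=1$ then $\alpha_0$ is not $\Omega$ or of the form $\vartheta\beta$. $E(\Omega)=\emptyset$, $E(\vartheta\alpha)=\{\vartheta\alpha\}$, $E(\langle\alpha_0,\dots\rangle)=\bigcup_iE(\alpha_i)$. $\alpha\prec\beta$ iff: (1) $\alpha=\Omega$, $\beta=\langle\beta_0,\dots,\beta_{n-1}\rangle$, $n>0$, $\Omega\preceq\beta_0$; or (2) $\alpha=\vartheta\alpha'$ and either $\beta=\Omega$, or $\beta=\langle\beta_0,\dots\rangle$ nonempty with $\alpha\preceq\beta_0$, or $\beta=\vartheta\beta'$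 with $\alpha'\prec\beta'$ and $\gamma\prec\beta$ for all $\gamma\in E(\alpha')$, or $\beta=\vartheta\beta'$ with $\alpha\preceq\gamma$ for some $\gamma\in E(\beta')$; or (3) $\alpha=\langle\alpha_0,\dots,\alpha_{m-1}\rangle$ and either $\beta\in\{\Omega\}\cup\{\vartheta\beta'\}$ with ($m=0$ or $\alpha_0\prec\beta$), or $\beta=\langle\beta_0,\dots,\beta_{n-1}\rangle$ is lexicographically larger ($\alpha$ a proper initial segment of $\beta$, or first difference $\alpha_j\prec\beta_j$). Numerals: $n:=\langle0,\dots,0\rangle$ ($n$ entries, $0=\langle\rangle$), $\omega:=\langle 1\rangle$. Arithmetic: identify $\Omega,\vartheta\alpha$ with $\langle\Omega\rangle,\langle\vartheta\alpha\rangle$; $\langle\alpha_0,\dots,\alpha_{m-1}\rangle+\langle\beta_0,\dots,\beta_{n-1}\rangle=\langle\alpha_0,\dots,\alpha_{k-1},\beta_0,\dots,\beta_{n-1}\rangle$ where $k$ is largest with $\beta_0\preceq\alpha_{k-1}$ (all of $\alpha$ if $n=0$; $k=0$ if no such); $\omega\cdot\Omega=\Omega$, $\omega\cdot\vartheta\alpha=\vartheta\alpha$, $\omega\cdot\langle\alpha_0,\dots\rangle=\langle1+\alpha_0,\dots\rangle$; $\Omega\cdot\langle\alpha_0,\dots,\alpha_{n-1}\rangle=\langle\Omega+\alpha_0,\dots,\Omega+\alpha_{n-1}\rangle$, $\Omega^2=\Omega\cdot\Omega$; $\omega(\alpha)=\alpha$ if $\alpha$ is $\Omega$ or of the form $\vartheta\alpha'$,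 and $\omega(\alpha)=\langle\alpha\rangle$ otherwise. Coefficient sets: $C_\alpha(\beta)$ is the least set containing $\Omega$ and all $\gamma\prec\beta$, containing $\vartheta\gamma$ whenever it contains $\gamma$ with $\gamma\prec\alpha$, and containing every term $\langle\gamma_0,\dots,\gamma_{n-1}\rangle$ whose entries it contains. $\mathcal H_\eta(Y)=\bigcap\{C_\gamma(\delta)\mid\eta\prec\gamma,\ Y\subseteq C_\gamma(\delta)\}$ (all terms if there are no such $\gamma,\delta$); $\mathcal H_\eta[X]$ is the operator $Y\mapsto\mathcal H_\eta(X\cup Y)$. Language: formulas are in negation normal form. An operator form is a formula $\varphi(x,X)$ of arithmetic with an extra unary predicate $X$, with one free number variable and no subformula $\neg Xt$. $\mathcal L^\Omega_{\mathsf{ID}}$ extends $\mathcal L_{\mathsf{PA}}$ by predicates $I^{\prec\alpha}_\varphi$ for each operator form $\varphi$ and term $\alpha\preceq\Omega$; $\varphi(t,I^{\prec\gamma}_\varphi)$ replaces $x$ by $t$ and $Xs$ by $I^{\prec\gamma}_\varphi s$. A sequent is a finite set of sentences. Each sentence is assigned a disjunction or conjunction: a false $\mathcal L_{\mathsf{PA}}$-literal $\simeq$ empty disjunction; $I^{\prec\alpha}_\varphi t\simeq\bigvee_{\gamma\prec\alpha}\varphi(t,I^{\prec\gamma}_\varphi)$; $\psi_0\lor\psi_1\simeq\bigvee_{i\prec2}\psi_i$; $\exists x\,\psi(x)\simeq\bigvee_{n\prec\omega}\psi(n)$; and $\neg\psi\simeq\bigwedge_{\gamma\prec\alpha}\neg\psi_\gamma$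 whenever $\psi\simeq\bigvee_{\gamma\prec\alpha}\psi_\gamma$. Ranks: $\operatorname{rk}=0$ for $\mathcal L_{\mathsf{PA}}$-literals, $\operatorname{rk}(\pm I^{\prec\alpha}_\varphi t)=\omega\cdot\alpha$, $\operatorname{rk}(\psi_0\lor\psi_1)=\operatorname{rk}(\psi_0\land\psi_1)=\max(\operatorname{rk}\psi_0,\operatorname{rk}\psi_1)+1$, $\operatorname{rk}(\exists x\psi)=\operatorname{rk}(\forall x\psi)=\operatorname{rk}(\psi)+1$. $k(\psi)$ is the set of $\alpha$ such that $\psi$ contains a literal $I^{\prec\alpha}_\varphi t$ or $\neg I^{\prec\alpha}_\varphi t$; $k(\Gamma)=\bigcup_{\psi\in\Gamma}k(\psi)$. Operators: a nice operator is $\mathcal H$ from subsets of terms to subsets of terms with $X\subseteq\mathcal H(X)$, ($X\subseteq\mathcal H(Y)\Rightarrow\mathcal H(X)\subseteq\mathcal H(Y)$), and ($\alpha\in\mathcal H(X)\Leftrightarrow E(\alpha)\subseteq\mathcal H(X)$); $\mathcal H[Z](X):=\mathcal H(Z\cup X)$. Derivations: $\mathcal H\vdash^\alpha_\rho\Gamma$ is defined by recursion on $\alpha$: it holds iff $\{\alpha\}\cup k(\Gamma)\subseteq\mathcal H(\emptyset)$ and one of: ($\bigwedge$) some $\psi\simeq\bigwedge_{\gamma\prec\delta}\psi_\gamma$ in $\Gamma$ such that for every $\gamma\prec\delta$ there is $\alpha(\gamma)\prec\alpha$ with $\mathcal H[\{\gamma\}]\vdash^{\alpha(\gamma)}_\rho\Gamma\cup\{\psi_\gamma\}$;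 ($\bigvee$) some $\psi\simeq\bigvee_{\gamma\prec\delta}\psi_\gamma$ in $\Gamma$, some $\gamma\prec\delta$ with $\gamma\prec\alpha$ and $\gamma\in\mathcal H(\emptyset)$, and $\alpha'\prec\alpha$ with $\mathcal H\vdash^{\alpha'}_\rho\Gamma\cup\{\psi_\gamma\}$; (Cut) some sentence $\psi$ with $\operatorname{rk}(\psi)\prec\rho$ and $\alpha'\prec\alpha$ with $\mathcal H\vdash^{\alpha'}_\rho\Gamma\cup\{\psi\}$ and $\mathcal H\vdash^{\alpha'}_\rho\Gamma\cup\{\neg\psi\}$; (Fix) $\Omega\preceq\alpha$, some $I^{\prec\Omega}_\varphi t\in\Gamma$ and $\alpha'\prec\alpha$ with $\mathcal H\vdash^{\alpha'}_\rho\Gamma\cup\{\varphi(t,I^{\prec\Omega}_\varphi)\}$. *)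

theory Defs
  imports Main
begin

section \<open>Ordinal terms\<close>

text \<open>
  The order is defined on all raw terms by recursion on their size; the set \<open>OT\<close> of genuine terms
  \<open>\<vartheta>(\<epsilon>\<^bsub>\<Omega>+1\<^esub>)\<close> is then carved out with its help. The term
  \<open>\<langle>\<alpha>\<^sub>0, \<dots>, \<alpha>\<^bsub>n-1\<^esub>\<rangle>\<close> is \<open>Sq [\<alpha>\<^sub>0, \<dots>, \<alpha>\<^bsub>n-1\<^esub>]\<close>.
\<close>

datatype oterm = Om | Th oterm | Sq "oterm list"

primrec Eset :: "oterm \<Rightarrow> oterm set" where
  "Eset Om = {}"
| "Eset (Th a) = {Th a}"
| "Eset (Sq as) = \<Union> (set (map Eset as))"

lemma size_Eset: "c \<in> Eset a \<Longrightarrow> size c \<le> size a"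
proof (induction a)
  case (Sq as)
  then obtain a where "a \<in> set as" "c \<in> Eset a" by auto
  moreover from this Sq.IH have "size c \<le> size a" by blast
  moreover from \<open>a \<in> set as\<close> have "size a \<le> size_list size as"
    by (simp add: size_list_estimation')
  ultimately show ?case by simp
qed auto

function (sequential) prec :: "oterm \<Rightarrow> oterm \<Rightarrow> bool"  (infix \<open>\<prec>\<close> 50) where
  "Om \<prec> Sq (b # bs) \<longleftrightarrow> Om \<prec> b \<or> Om = b"
| "Om \<prec> _ \<longleftrightarrow> False"
| "Th a \<prec> Om \<longleftrightarrow> True"
| "Th a \<prec> Sq [] \<longleftrightarrow> False"
| "Th a \<prec> Sq (b # bs) \<longleftrightarrow> Th a \<prec> b \<or> Th a = b"
| "Th a \<prec> Th b \<longleftrightarrow>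
     (a \<prec> b \<and> (\<forall>c\<in>Eset a. c \<prec> Th b)) \<or> (\<exists>c\<in>Eset b. Th a \<prec> c \<or> Th a = c)"
| "Sq as \<prec> Sq bs \<longleftrightarrow>
     (length as < length bs \<and> take (length as) bs = as) \<or>
     (\<exists>j\<in>{..<min (length as) (length bs)}. take j as = take j bs \<and> as ! j \<prec> bs ! j)"
| "Sq [] \<prec> b \<longleftrightarrow> True"
| "Sq (a # as) \<prec> b \<longleftrightarrow> a \<prec> b"
  by pat_completeness auto
termination
proof (relation "measure (\<lambda>(a, b). size a + size b)", goal_cases)
  case (7 as bs j)
  then have "size (as ! j) \<le> size_list size as" "size (bs ! j) \<le> size_list size bs"
    by (auto intro!: size_list_estimation'[OF nth_mem])
  then show ?case by simp
qed (auto dest: size_Eset)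

abbreviation preceq :: "oterm \<Rightarrow> oterm \<Rightarrow> bool"  (infix \<open>\<preceq>\<close> 50) where
  "a \<preceq> b \<equiv> a \<prec> b \<or> a = b"

primrec principal :: "oterm \<Rightarrow> bool" where
  "principal Om = True"
| "principal (Th a) = True"
| "principal (Sq as) = False"

inductive_set OT :: "oterm set" where
  "Om \<in> OT"
| "a \<in> OT \<Longrightarrow> Th a \<in> OT"
| "(\<And>a. a \<in> set as \<Longrightarrow> a \<in> OT) \<Longrightarrow>
     (length as > 1 \<Longrightarrow> successively (\<lambda>a b. b \<preceq> a) as) \<Longrightarrow>
     (length as = 1 \<Longrightarrow> \<not> principal (hd as)) \<Longrightarrow> Sq as \<in> OT"

definition seg :: "oterm \<Rightarrow> oterm set" where
  "seg a = {c \<in> OT. c \<prec> a}"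

section \<open>Ordinal arithmetic\<close>

definition onum :: "nat \<Rightarrow> oterm" where
  "onum n = Sq (replicate n (Sq []))"

definition oomega :: oterm where
  "oomega = Sq [onum 1]"

text \<open>\<open>entries\<close> and \<open>mk_seq\<close> implement the identification of \<open>\<Omega>\<close> and \<open>\<vartheta>\<alpha>\<close> with \<open>\<langle>\<Omega>\<rangle>\<close> and \<open>\<langle>\<vartheta>\<alpha>\<rangle>\<close>.\<close>

primrec entries :: "oterm \<Rightarrow> oterm list" where
  "entries Om = [Om]"
| "entries (Th a) = [Th a]"
| "entries (Sq as) = as"

definition mk_seq :: "oterm list \<Rightarrow> oterm" where
  "mk_seq as = (if length as = 1 \<and> principal (hd as) then hd as else Sq as)"

definition oadd :: "oterm \<Rightarrow> oterm \<Rightarrow> oterm"  (infixl \<open>\<oplus>\<close> 65) where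
  "a \<oplus> b =
    (let as = entries a; bs = entries b;
         k = (if bs = [] then length as
              else GREATEST k. k \<le> length as \<and> (k = 0 \<or> hd bs \<preceq> as ! (k - 1)))
     in mk_seq (take k as @ bs))"

primrec omega_times :: "oterm \<Rightarrow> oterm" where
  "omega_times Om = Om"
| "omega_times (Th a) = Th a"
| "omega_times (Sq as) = mk_seq (map (\<lambda>a. onum 1 \<oplus> a) as)"

definition Omega_times :: "oterm \<Rightarrow> oterm" where
  "Omega_times a = mk_seq (map (\<lambda>c. Om \<oplus> c) (entries a))"

definition omega_of :: "oterm \<Rightarrow> oterm" where
  "omega_of a = (if principal a then a else Sq [a])"

definition omax :: "oterm \<Rightarrow> oterm \<Rightarrow> oterm" where
  "omax a b = (if a \<preceq> b then b else a)"

definition phibar :: "oterm \<Rightarrow> oterm \<Rightarrow> oterm" where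
  "phibar a b = Th (Omega_times a \<oplus> b)"

section \<open>Operators\<close>

inductive_set Cset :: "oterm \<Rightarrow> oterm \<Rightarrow> oterm set" for a b :: oterm where
  "Om \<in> Cset a b"
| "c \<in> seg b \<Longrightarrow> c \<in> Cset a b"
| "c \<in> Cset a b \<Longrightarrow> c \<prec> a \<Longrightarrow> Th c \<in> Cset a b"
| "(\<And>c. c \<in> set cs \<Longrightarrow> c \<in> Cset a b) \<Longrightarrow> Sq cs \<in> OT \<Longrightarrow> Sq cs \<in> Cset a b"

definition Hop :: "oterm \<Rightarrow> oterm set \<Rightarrow> oterm set" where
  "Hop e Y = OT \<inter> \<Inter> {Cset c d | c d. c \<in> OT \<and> d \<in> OT \<and> e \<prec> c \<and> Y \<subseteq> Cset c d}"

definition adjoin :: "(oterm set \<Rightarrow> oterm set) \<Rightarrow> oterm set \<Rightarrow> oterm set \<Rightarrow> oterm set" where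
  "adjoin H Z = (\<lambda>X. H (Z \<union> X))"

section \<open>Formulas\<close>

datatype aterm = Var nat | Zero | Succ aterm | Plus aterm aterm | Times aterm aterm

primrec tfv :: "aterm \<Rightarrow> nat set" where
  "tfv (Var x) = {x}"
| "tfv Zero = {}"
| "tfv (Succ s) = tfv s"
| "tfv (Plus s t) = tfv s \<union> tfv t"
| "tfv (Times s t) = tfv s \<union> tfv t"

primrec tsubst :: "nat \<Rightarrow> aterm \<Rightarrow> aterm \<Rightarrow> aterm" where
  "tsubst x r (Var y) = (if y = x then r else Var y)"
| "tsubst x r Zero = Zero"
| "tsubst x r (Succ s) = Succ (tsubst x r s)"
| "tsubst x r (Plus s t) = Plus (tsubst x r s) (tsubst x r t)"
| "tsubst x r (Times s t) = Times (tsubst x r s) (tsubst x r t)"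

primrec tval :: "(nat \<Rightarrow> nat) \<Rightarrow> aterm \<Rightarrow> nat" where
  "tval e (Var x) = e x"
| "tval e Zero = 0"
| "tval e (Succ s) = Suc (tval e s)"
| "tval e (Plus s t) = tval e s + tval e t"
| "tval e (Times s t) = tval e s * tval e t"

definition anum :: "nat \<Rightarrow> aterm" where
  "anum n = (Succ ^^ n) Zero"

text \<open>Formulas of arithmetic in negation normal form with unary predicates drawn from \<open>'p\<close>.\<close>

datatype 'p fml =
    Eq aterm aterm | Neq aterm aterm
  | Pred 'p aterm | NPred 'p aterm
  | Or "'p fml" "'p fml" | And "'p fml" "'p fml"
  | Ex nat "'p fml" | All nat "'p fml"

primrec neg :: "'p fml \<Rightarrow> 'p fml" where
  "neg (Eq s t) = Neq s t"
| "neg (Neq s t) = Eq s t"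
| "neg (Pred p t) = NPred p t"
| "neg (NPred p t) = Pred p t"
| "neg (Or A B) = And (neg A) (neg B)"
| "neg (And A B) = Or (neg A) (neg B)"
| "neg (Ex x A) = All x (neg A)"
| "neg (All x A) = Ex x (neg A)"

primrec fv :: "'p fml \<Rightarrow> nat set" where
  "fv (Eq s t) = tfv s \<union> tfv t"
| "fv (Neq s t) = tfv s \<union> tfv t"
| "fv (Pred p t) = tfv t"
| "fv (NPred p t) = tfv t"
| "fv (Or A B) = fv A \<union> fv B"
| "fv (And A B) = fv A \<union> fv B"
| "fv (Ex x A) = fv A - {x}"
| "fv (All x A) = fv A - {x}"

text \<open>This substitution does not rename bound variables; it is only used with closed \<open>r\<close>.\<close>

primrec subst :: "nat \<Rightarrow> aterm \<Rightarrow> 'p fml \<Rightarrow> 'p fml" where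
  "subst x r (Eq s t) = Eq (tsubst x r s) (tsubst x r t)"
| "subst x r (Neq s t) = Neq (tsubst x r s) (tsubst x r t)"
| "subst x r (Pred p t) = Pred p (tsubst x r t)"
| "subst x r (NPred p t) = NPred p (tsubst x r t)"
| "subst x r (Or A B) = Or (subst x r A) (subst x r B)"
| "subst x r (And A B) = And (subst x r A) (subst x r B)"
| "subst x r (Ex y A) = Ex y (if y = x then A else subst x r A)"
| "subst x r (All y A) = All y (if y = x then A else subst x r A)"

primrec positive :: "'p fml \<Rightarrow> bool" where
  "positive (Eq s t) = True"
| "positive (Neq s t) = True"
| "positive (Pred p t) = True"
| "positive (NPred p t) = False"
| "positive (Or A B) = (positive A \<and> positive B)"
| "positive (And A B) = (positive A \<and> positive B)"
| "positive (Ex x A) = positive A"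
| "positive (All x A) = positive A"

text \<open>
  Formulas of arithmetic with the extra predicate \<open>X\<close> are elements of \<^typ>\<open>unit fml\<close>. The predicate
  \<open>I\<^sub>\<phi>\<^bsup>\<prec>\<alpha>\<^esup>\<close> is the pair \<open>(\<phi>, \<alpha>)\<close>.
\<close>

type_synonym idfml = "(unit fml \<times> oterm) fml"

definition operator_form :: "unit fml \<Rightarrow> bool" where
  "operator_form \<phi> \<longleftrightarrow> positive \<phi> \<and> (\<exists>x. fv \<phi> = {x})"

definition op_inst :: "unit fml \<Rightarrow> aterm \<Rightarrow> oterm \<Rightarrow> idfml" where
  "op_inst \<phi> t c = map_fml (\<lambda>_. (\<phi>, c)) (subst (THE x. fv \<phi> = {x}) t \<phi>)"

definition sentence :: "idfml \<Rightarrow> bool" where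
  "sentence A \<longleftrightarrow> fv A = {} \<and>
     (\<forall>(\<phi>, a) \<in> set_fml A. operator_form \<phi> \<and> a \<in> OT \<and> a \<preceq> Om)"

definition sequent :: "idfml set \<Rightarrow> bool" where
  "sequent \<Gamma> \<longleftrightarrow> finite \<Gamma> \<and> (\<forall>A\<in>\<Gamma>. sentence A)"

definition kset :: "idfml set \<Rightarrow> oterm set" where
  "kset \<Gamma> = (\<Union>A\<in>\<Gamma>. snd ` set_fml A)"

primrec rk :: "idfml \<Rightarrow> oterm" where
  "rk (Eq s t) = onum 0"
| "rk (Neq s t) = onum 0"
| "rk (Pred p t) = omega_times (snd p)"
| "rk (NPred p t) = omega_times (snd p)"
| "rk (Or A B) = omax (rk A) (rk B) \<oplus> onum 1"
| "rk (And A B) = omax (rk A) (rk B) \<oplus> onum 1"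
| "rk (Ex x A) = rk A \<oplus> onum 1"
| "rk (All x A) = rk A \<oplus> onum 1"

text \<open>
  \<open>disj_of A d f\<close> means \<open>A \<simeq> \<Or>\<^bsub>\<gamma>\<prec>d\<^esub> f \<gamma>\<close>, and \<open>conj_of A d f\<close> means \<open>A \<simeq> \<And>\<^bsub>\<gamma>\<prec>d\<^esub> f \<gamma>\<close>, for sentences \<open>A\<close>;
  values of \<open>f\<close> outside \<open>seg d\<close> are irrelevant. The elements of \<open>seg oomega\<close> are the numerals.
\<close>

inductive disj_of :: "idfml \<Rightarrow> oterm \<Rightarrow> (oterm \<Rightarrow> idfml) \<Rightarrow> bool" where
  "(\<And>e. tval e s \<noteq> tval e t) \<Longrightarrow> disj_of (Eq s t) (onum 0) f"
| "(\<And>e. tval e s = tval e t) \<Longrightarrow> disj_of (Neq s t) (onum 0) f"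
| "(\<And>c. c \<in> seg a \<Longrightarrow> f c = op_inst \<phi> t c) \<Longrightarrow> disj_of (Pred (\<phi>, a) t) a f"
| "f (onum 0) = A \<Longrightarrow> f (onum 1) = B \<Longrightarrow> disj_of (Or A B) (onum 2) f"
| "(\<And>n. f (onum n) = subst x (anum n) A) \<Longrightarrow> disj_of (Ex x A) oomega f"

inductive conj_of :: "idfml \<Rightarrow> oterm \<Rightarrow> (oterm \<Rightarrow> idfml) \<Rightarrow> bool" where
  "disj_of A d f \<Longrightarrow> conj_of (neg A) d (\<lambda>c. neg (f c))"

section \<open>Derivations\<close>

text \<open>
  \<open>deriv \<rho> H \<alpha> \<Gamma>\<close> is \<open>H \<turnstile>\<^sub>\<rho>\<^sup>\<alpha> \<Gamma>\<close>. As every premise of a rule carries a smaller ordinal term, the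
  inductive definition agrees with the recursion on \<open>\<alpha>\<close> along the well-founded order \<open>\<prec>\<close> on \<open>OT\<close>.
\<close>

inductive deriv :: "oterm \<Rightarrow> (oterm set \<Rightarrow> oterm set) \<Rightarrow> oterm \<Rightarrow> idfml set \<Rightarrow> bool"
  for \<rho> :: oterm where
  Conj: "{\<alpha>} \<union> kset \<Gamma> \<subseteq> H {} \<Longrightarrow> A \<in> \<Gamma> \<Longrightarrow> conj_of A d f \<Longrightarrow>
     (\<And>c. c \<in> seg d \<Longrightarrow> \<exists>\<alpha>'\<in>seg \<alpha>. deriv \<rho> (adjoin H {c}) \<alpha>' (\<Gamma> \<union> {f c})) \<Longrightarrow>
     deriv \<rho> H \<alpha> \<Gamma>"
| Disj: "{\<alpha>} \<union> kset \<Gamma> \<subseteq> H {} \<Longrightarrow> A \<in> \<Gamma> \<Longrightarrow> disj_of A d f \<Longrightarrow>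
     c \<in> seg d \<Longrightarrow> c \<prec> \<alpha> \<Longrightarrow> c \<in> H {} \<Longrightarrow>
     \<alpha>' \<in> seg \<alpha> \<Longrightarrow> deriv \<rho> H \<alpha>' (\<Gamma> \<union> {f c}) \<Longrightarrow>
     deriv \<rho> H \<alpha> \<Gamma>"
| Cut: "{\<alpha>} \<union> kset \<Gamma> \<subseteq> H {} \<Longrightarrow> sentence A \<Longrightarrow> rk A \<prec> \<rho> \<Longrightarrow>
     \<alpha>' \<in> seg \<alpha> \<Longrightarrow> deriv \<rho> H \<alpha>' (\<Gamma> \<union> {A}) \<Longrightarrow> deriv \<rho> H \<alpha>' (\<Gamma> \<union> {neg A}) \<Longrightarrow>
     deriv \<rho> H \<alpha> \<Gamma>"
| Fix: "{\<alpha>} \<union> kset \<Gamma> \<subseteq> H {} \<Longrightarrow> Om \<preceq> \<alpha> \<Longrightarrow> Pred (\<phi>, Om) t \<in> \<Gamma> \<Longrightarrow>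
     \<alpha>' \<in> seg \<alpha> \<Longrightarrow> deriv \<rho> H \<alpha>' (\<Gamma> \<union> {op_inst \<phi> t Om}) \<Longrightarrow>
     deriv \<rho> H \<alpha> \<Gamma>"

end

theory Submission
  imports Defs "HOL-Library.Multiset"
begin

text \<open>
  Main induction on \<open>\<alpha>\<close>, side induction on the derivation. A cut of rank \<open>\<sigma> \<succeq> \<rho>\<close> below \<open>\<rho> + \<omega>\<^bsup>\<alpha>\<^esup>\<close> either has
  \<open>\<sigma> = \<rho>\<close> and is removed by the usual reduction (inversion of the conjunctive side), or \<open>\<sigma>\<close> lies below
  \<open>\<rho> + \<omega>\<^bsup>\<alpha>'\<^esup> \<cdot> n\<close> for some \<open>\<alpha>' \<prec> \<alpha>\<close>, and the main induction hypothesis for \<open>\<alpha>'\<close> is applied \<open>n\<close> times. The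
  exponent \<open>\<alpha>'\<close> can be read off \<open>\<sigma>\<close>, hence it is controlled by the operator, and all heights stay below
  \<open>\<vartheta>(\<Omega>\<cdot>\<alpha> + \<beta>)\<close> because that term is closed under \<open>\<delta> \<mapsto> \<vartheta>(\<Omega>\<cdot>\<alpha>' + \<delta>)\<close>.

  The main induction needs the order to be well-founded below \<open>\<Omega>\<close>. Let \<open>W\<close> be the accessible part of the
  terms below \<open>\<Omega>\<close>, and \<open>V\<close> the accessible part of the set of terms \<open>a\<close> with \<open>E(a) \<subseteq> W\<close>. Both are closed under
  sequences, as lexicographic comparison of descending sequences is contained in the multiset order, and
  \<open>a \<in> V\<close> implies \<open>\<vartheta>a \<in> W\<close>. Thus every term lies in \<open>V\<close>.
\<close>

subsection \<open>The order on terms\<close>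

lemma Eset_is_Th: "e \<in> Eset a \<Longrightarrow> \<exists>x. e = Th x"
  by (induction a) auto

lemma size_Eset_Th: "e \<in> Eset a \<Longrightarrow> size e < size (Th a)"
  using size_Eset by fastforce

lemma not_prec_Sq_Nil [simp]: "\<not> a \<prec> Sq []"
  by (cases a) auto

lemma Sq_Nil_prec [simp]: "Sq [] \<prec> a \<longleftrightarrow> a \<noteq> Sq []"
proof (cases a)
  case (Sq as)
  then show ?thesis by (cases as) auto
qed auto

text \<open>Makes lexicographic comparison accessible to induction on lists. It takes the place of
  the positional equation \<open>prec.simps(9)\<close>, which leaves the simpset right
  afterwards.\<close>

lemma Sq_Cons_prec_Sq_Cons [simp]:
  "Sq (a # as) \<prec> Sq (b # bs) \<longleftrightarrow> a \<prec> b \<or> a = b \<and> Sq as \<prec> Sq bs" (is "?l \<longleftrightarrow> ?r")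
proof
  assume ?l
  then consider "length as < length bs" "b = a" "take (length as) bs = as"
    | j where "j < Suc (min (length as) (length bs))" "take j (a # as) = take j (b # bs)"
        "(a # as) ! j \<prec> (b # bs) ! j"
    by (auto simp del: take_Cons')
  then show ?r
  proof cases
    case (2 j)
    then show ?thesis by (cases j) auto
  qed auto
next
  assume ?r
  then consider "a \<prec> b" | "a = b" "length as < length bs" "take (length as) bs = as"
    | j where "a = b" "j < min (length as) (length bs)" "take j as = take j bs" "as ! j \<prec> bs ! j"
    by auto
  then show ?l
  proof cases
    case 1
    then show ?thesis by (auto intro!: bexI[of _ 0])
  next
    case 3
    then show ?thesis by (auto intro!: bexI[of _ "Suc j"])
  qed auto
qed

declare prec.simps(9) [simp del]

lemma Th_Eset: "e \<in> Eset a \<Longrightarrow> e \<prec> Th a"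
  using Eset_is_Th by fastforce

lemma prec_Sq_Cons_principal: "principal p \<Longrightarrow> p \<prec> Sq (b # bs) \<longleftrightarrow> p \<preceq> b"
  by (cases p) auto

lemma Sq_Cons_prec_principal: "principal p \<Longrightarrow> Sq (a # as) \<prec> p \<longleftrightarrow> a \<prec> p"
  by (cases p) auto

lemma principal_cases: "principal p \<or> p = Sq [] \<or> (\<exists>a as. p = Sq (a # as))"
  by (cases p) (auto, metis list.exhaust)

text \<open>Transitivity is assumed for the entries only, since that is all the size induction in
  \<open>prec_trans\<close> can supply.\<close>

lemma prec_Sq_lists_trans:
  assumes "\<And>a b c. a \<in> set as \<Longrightarrow> b \<in> set bs \<Longrightarrow> c \<in> set cs \<Longrightarrow> a \<prec> b \<Longrightarrow> b \<prec> c \<Longrightarrow> a \<prec> c"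
    and "Sq as \<prec> Sq bs" "Sq bs \<prec> Sq cs"
  shows "Sq as \<prec> Sq cs"
  using assms
proof (induction as arbitrary: bs cs)
  case Nil
  then show ?case by (cases cs) auto
next
  case (Cons a as)
  then obtain b bs' c cs' where bc: "bs = b # bs'" "cs = c # cs'"
    by (metis list.exhaust not_prec_Sq_Nil)
  have "Sq as \<prec> Sq cs'" if "Sq as \<prec> Sq bs'" "Sq bs' \<prec> Sq cs'"
    by (rule Cons.IH[OF _ that]) (use Cons.prems(1) bc in auto)
  then show ?case using Cons.prems bc by auto
qed

text \<open>Induction on the total size. Each clause of the order strips a constructor or passes
  from \<open>Th x\<close> to an element of \<open>Eset x\<close>, so the chains to be composed are
  smaller than the given one.\<close>

lemma prec_trans: "a \<prec> b \<Longrightarrow> b \<prec> c \<Longrightarrow> a \<prec> c"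
proof (induction "size a + size b + size c" arbitrary: a b c rule: less_induct)
  case less
  note IH = less.hyps and ab = less.prems(1) and bc = less.prems(2)
  have IHle: "x \<prec> z" if "x \<prec> y" "y \<preceq> z" "size x + size y + size z < size a + size b + size c" for x y z
    using IH[OF that(3)] that by blast
  have IHle': "x \<prec> z" if "x \<preceq> y" "y \<prec> z" "size x + size y + size z < size a + size b + size c" for x y z
    using IH[OF that(3)] that by blast
  consider (cNil) "c = Sq []" | (aNil) "a = Sq []" | (bNil) "b = Sq []"
    | (ppp) "principal a" "principal b" "principal c"
    | (pps) c0 cs where "principal a" "principal b" "c = Sq (c0 # cs)"
    | (psp) b0 bs where "principal a" "b = Sq (b0 # bs)" "principal c"
    | (pss) b0 bs c0 cs where "principal a" "b = Sq (b0 # bs)" "c = Sq (c0 # cs)"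
    | (spp) a0 as where "a = Sq (a0 # as)" "principal b" "principal c"
    | (sps) a0 as c0 cs where "a = Sq (a0 # as)" "principal b" "c = Sq (c0 # cs)"
    | (ssp) a0 as b0 bs where "a = Sq (a0 # as)" "b = Sq (b0 # bs)" "principal c"
    | (sss) a0 as b0 bs c0 cs where "a = Sq (a0 # as)" "b = Sq (b0 # bs)" "c = Sq (c0 # cs)"
    using principal_cases by metis
  then show ?case
  proof cases
    case cNil
    then show ?thesis using bc by simp
  next
    case aNil
    then show ?thesis using bc by auto
  next
    case bNil
    then show ?thesis using ab by simp
  next
    case ppp
    show ?thesis
    proof (cases c)
      case Om
      then show ?thesis using ppp ab bc by (cases a; cases b) auto
    next
      case (Th c')
      obtain b' where b: "b = Th b'" using ppp bc Th by (cases b) auto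
      obtain a' where a: "a = Th a'" using ppp ab b by (cases a) auto
      show ?thesis
      \<comment> \<open>The two ways of comparing \<vartheta>-terms are separated, first for
        \<open>b\<close> and \<open>c\<close>, then for \<open>a\<close> and \<open>b\<close>. Only
        if both comparisons use the first clause are the arguments themselves composed.\<close>
      proof (cases "\<exists>e\<in>Eset c'. b \<preceq> e")
        case True
        then obtain e where e: "e \<in> Eset c'" "b \<preceq> e" by blast
        have "a \<prec> e"
          by (rule IHle[OF ab e(2)]) (use size_Eset[OF e(1)] Th in simp)
        then show ?thesis using e Th a by auto
      next
        case False
        then have bc': "b' \<prec> c'" "\<And>e. e \<in> Eset b' \<Longrightarrow> e \<prec> c" using bc b Th by auto
        show ?thesis
        proof (cases "\<exists>e\<in>Eset b'. a \<preceq> e")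
          case True
          then obtain e where e: "e \<in> Eset b'" "a \<preceq> e" by blast
          show ?thesis
            by (rule IHle'[OF e(2) bc'(2)]) (use size_Eset[OF e(1)] e b in simp_all)
        next
          case False
          then have ab': "a' \<prec> b'" "\<And>e. e \<in> Eset a' \<Longrightarrow> e \<prec> b" using ab a b by auto
          have "a' \<prec> c'" by (rule IH[OF _ ab'(1) bc'(1)]) (simp add: a b Th)
          moreover have "e \<prec> c" if "e \<in> Eset a'" for e
            by (rule IH[OF _ ab'(2)[OF that] bc]) (use size_Eset[OF that] a in simp)
          ultimately show ?thesis using a Th by auto
        qed
      qed
    qed (use ppp in auto)
  next
    case pps
    then have "b \<preceq> c0" using bc prec_Sq_Cons_principal by metis
    with ab have "a \<prec> c0" by (rule IHle) (use pps in simp)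
    then show ?thesis using pps prec_Sq_Cons_principal by metis
  next
    case psp
    then have "a \<preceq> b0" "b0 \<prec> c"
      using ab bc prec_Sq_Cons_principal Sq_Cons_prec_principal by metis+
    then show ?thesis by (rule IHle') (use psp in simp)
  next
    case pss
    then have h: "a \<preceq> b0" "b0 \<preceq> c0" using ab bc prec_Sq_Cons_principal by (metis, auto)
    then have "a \<preceq> c0"
      using IH[of a b0 c0] pss by auto
    then show ?thesis using pss prec_Sq_Cons_principal by metis
  next
    case spp
    then have "a0 \<prec> b" using ab Sq_Cons_prec_principal by metis
    then have "a0 \<prec> c" using IH[of a0 b c] bc spp by auto
    then show ?thesis using spp Sq_Cons_prec_principal by metis
  next
    case sps
    then have "a0 \<prec> b" "b \<preceq> c0"
      using ab bc prec_Sq_Cons_principal Sq_Cons_prec_principal by metis+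
    then have "a0 \<prec> c0" by (rule IHle) (use sps in simp)
    then show ?thesis using sps by simp
  next
    case ssp
    then have "a0 \<preceq> b0" "b0 \<prec> c" using ab bc Sq_Cons_prec_principal by auto
    then have "a0 \<prec> c" by (rule IHle') (use ssp in simp)
    then show ?thesis using ssp Sq_Cons_prec_principal by metis
  next
    case sss
    have "x \<prec> z" if xyz: "x \<in> set (a0 # as)" "y \<in> set (b0 # bs)" "z \<in> set (c0 # cs)" "x \<prec> y" "y \<prec> z"
      for x y z
    proof (rule IH[OF _ xyz(4,5)])
      show "size x + size y + size z < size a + size b + size c"
        using size_list_estimation'[OF xyz(1) order_refl, of size]
          size_list_estimation'[OF xyz(2) order_refl, of size]
          size_list_estimation'[OF xyz(3) order_refl, of size] sss by simp
    qed
    then show ?thesis using prec_Sq_lists_trans[of "a0 # as" "b0 # bs" "c0 # cs"] ab bc sss by blast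
  qed
qed

lemma preceq_prec_trans: "a \<preceq> b \<Longrightarrow> b \<prec> c \<Longrightarrow> a \<prec> c"
  using prec_trans by blast

lemma prec_preceq_trans: "a \<prec> b \<Longrightarrow> b \<preceq> c \<Longrightarrow> a \<prec> c"
  using prec_trans by blast

lemma preceq_trans: "a \<preceq> b \<Longrightarrow> b \<preceq> c \<Longrightarrow> a \<preceq> c"
  using prec_trans by blast

text \<open>A loop at \<open>Th b\<close> through some \<open>c\<close> in \<open>Eset b\<close>
  would yield \<open>c \<prec> Th b \<preceq> c\<close>, a loop at a smaller term.\<close>

lemma prec_irrefl [simp]: "\<not> a \<prec> a"
proof (induction "size a" arbitrary: a rule: less_induct)
  case less
  show ?case
  proof (cases a)
    case (Th b)
    have "\<not> b \<prec> b" using less[of b] Th by simp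
    moreover have "\<not> Th b \<preceq> c" if c: "c \<in> Eset b" for c
    proof
      assume "Th b \<preceq> c"
      then have "c \<prec> c" using Th_Eset[OF c] prec_trans by blast
      then show False using less[of c] size_Eset_Th[OF c] Th by simp
    qed
    ultimately show ?thesis using Th by auto
  next
    case (Sq as)
    have "\<not> Sq bs \<prec> Sq bs" if "\<And>b. b \<in> set bs \<Longrightarrow> \<not> b \<prec> b" for bs
      using that by (induction bs) auto
    moreover have "\<not> b \<prec> b" if b: "b \<in> set as" for b
      using less[of b] size_list_estimation'[OF b order_refl, of size] Sq by simp
    ultimately show ?thesis using Sq by blast
  qed auto
qed

lemma prec_asym: "a \<prec> b \<Longrightarrow> \<not> b \<prec> a"
  using prec_trans prec_irrefl by blast

lemma prec_linear: "a \<prec> b \<or> a = b \<or> b \<prec> a"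
proof (induction "size a + size b" arbitrary: a b rule: less_induct)
  case less
  have sp: "Sq (c # cs) \<prec> p \<or> Sq (c # cs) = p \<or> p \<prec> Sq (c # cs)"
    if "principal p" "size c + size p < size a + size b" for c cs p
    using that less[of c p] Sq_Cons_prec_principal prec_Sq_Cons_principal by metis
  \<comment> \<open>When \<open>c \<prec> d\<close>, the only obstacle to
    \<open>Th c \<prec> Th d\<close> is some \<open>e\<close> in \<open>Eset c\<close> with
    \<open>Th d \<preceq> e\<close>, and that gives \<open>Th d \<prec> Th c\<close>.\<close>
  have th: "Th c \<prec> Th d \<or> Th d \<prec> Th c" if cd: "a = Th c \<and> b = Th d \<or> a = Th d \<and> b = Th c" "c \<prec> d" for c d
  proof (cases "\<forall>e\<in>Eset c. e \<prec> Th d")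
    case False
    then obtain e where e: "e \<in> Eset c" "\<not> e \<prec> Th d" by blast
    then have "Th d \<preceq> e" using less[of e "Th d"] size_Eset_Th[OF e(1)] cd(1) by auto
    then show ?thesis using e by auto
  qed (use cd in auto)
  have sq: "Sq cs \<prec> Sq ds \<or> cs = ds \<or> Sq ds \<prec> Sq cs"
    if "\<And>c d. c \<in> set cs \<Longrightarrow> d \<in> set ds \<Longrightarrow> c \<prec> d \<or> c = d \<or> d \<prec> c" for cs ds
    using that
  proof (induction cs arbitrary: ds)
    case (Cons c cs)
    show ?case
    proof (cases ds)
      case (Cons d ds')
      then show ?thesis using Cons.IH[of ds'] Cons.prems by auto
    qed simp
  qed simp
  consider "a = Sq [] \<or> b = Sq []" | "principal a" "principal b"
    | a0 as where "a = Sq (a0 # as)" "principal b"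
    | b0 bs where "principal a" "b = Sq (b0 # bs)"
    | a0 as b0 bs where "a = Sq (a0 # as)" "b = Sq (b0 # bs)"
    using principal_cases by metis
  then show ?case
  proof cases
    case 1
    then show ?thesis by auto
  next
    case 2
    show ?thesis
    proof (cases a)
      case a: (Th a')
      show ?thesis
      proof (cases b)
        case b: (Th b')
        then show ?thesis using th[of a' b'] th[of b' a'] less[of a' b'] a by auto
      qed (use 2 a in auto)
    qed (use 2 in \<open>cases b; auto\<close>)+
  next
    case 3
    then show ?thesis using sp[of b a0 as] by auto
  next
    case 4
    then show ?thesis using sp[of a b0 bs] by auto
  next
    case 5
    have "c \<prec> d \<or> c = d \<or> d \<prec> c" if cd: "c \<in> set (a0 # as)" "d \<in> set (b0 # bs)" for c d
      using less[of c d] size_list_estimation'[OF cd(1) order_refl, of size]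
        size_list_estimation'[OF cd(2) order_refl, of size] 5 by simp
    then show ?thesis using sq[of "a0 # as" "b0 # bs"] 5 by blast
  qed
qed

lemma not_prec_iff: "\<not> a \<prec> b \<longleftrightarrow> b \<preceq> a"
  using prec_linear prec_asym prec_irrefl by blast

subsection \<open>Normal forms and well-foundedness\<close>

abbreviation desc :: "oterm list \<Rightarrow> bool" where
  "desc \<equiv> sorted_wrt (\<lambda>a b. b \<preceq> a)"

lemma successively_eq_desc: "successively (\<lambda>a b. b \<preceq> a) as \<longleftrightarrow> desc as"
  by (rule successively_iff_sorted_wrt_strong) (use preceq_trans in blast)

text \<open>Lists of length at most one are descending anyway, which is why \<open>desc\<close>
  appears without the length guard of the definition.\<close>

lemma Sq_in_OT_iff:
  "Sq as \<in> OT \<longleftrightarrow> set as \<subseteq> OT \<and> desc as \<and> (length as = 1 \<longrightarrow> \<not> principal (hd as))" (is "?l \<longleftrightarrow> ?r")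
proof
  assume ?l
  then show ?r
  proof cases
    case 3
    then show ?thesis
      by (cases "length as > 1") (auto simp: successively_eq_desc, cases as, auto)
  qed
next
  assume ?r
  then show ?l by (auto intro!: OT.intros(3) simp: successively_eq_desc)
qed

lemma Th_in_OT_iff [simp]: "Th a \<in> OT \<longleftrightarrow> a \<in> OT"
  using OT.cases[of "Th a"] OT.intros(2) by blast

lemma Om_in_OT [simp]: "Om \<in> OT"
  by (rule OT.intros)

lemma Sq_Nil_in_OT [simp]: "Sq [] \<in> OT"
  by (simp add: Sq_in_OT_iff)

lemma desc_hd: "desc (a # as) \<Longrightarrow> x \<in> set (a # as) \<Longrightarrow> x \<preceq> a"
  by auto

lemma OT_induct [consumes 1, case_names Om Th Sq]:
  assumes "a \<in> OT" "P Om" "\<And>a. a \<in> OT \<Longrightarrow> P a \<Longrightarrow> P (Th a)"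
    "\<And>as. Sq as \<in> OT \<Longrightarrow> (\<And>a. a \<in> set as \<Longrightarrow> P a) \<Longrightarrow> P (Sq as)"
  shows "P a"
  using assms(1)
proof (induction rule: OT.induct)
  case (3 as)
  then show ?case using assms(4) OT.intros(3) by blast
qed (use assms in auto)

lemma Eset_OT: "a \<in> OT \<Longrightarrow> e \<in> Eset a \<Longrightarrow> e \<in> OT"
  by (induction rule: OT_induct) auto

text \<open>Rests on the normal form: comparison with a sequence looks at its first entry, and only
  by descent does that entry bound the others.\<close>

lemma Eset_le: "a \<in> OT \<Longrightarrow> e \<in> Eset a \<Longrightarrow> e \<preceq> a"
proof (induction rule: OT_induct)
  case (Sq as)
  then obtain x where x: "x \<in> set as" "e \<in> Eset x" by auto
  then obtain a as' where as: "as = a # as'" by (cases as) auto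
  have "e \<preceq> x" using Sq x by blast
  moreover have "x \<preceq> a" using Sq.hyps x(1) unfolding Sq_in_OT_iff as by (auto intro: desc_hd)
  ultimately have "e \<preceq> a" using preceq_trans by blast
  then show ?case using as Eset_is_Th[OF x(2)] by auto
qed auto

text \<open>Principal terms act as epsilon numbers: the comparison inspects only the first entry,
  which by descent bounds the rest.\<close>

lemma Sq_prec_principal_iff:
  assumes "Sq as \<in> OT" "principal p"
  shows "Sq as \<prec> p \<longleftrightarrow> (\<forall>a\<in>set as. a \<prec> p)"
proof (cases as)
  case Nil
  then show ?thesis using assms by auto
next
  case (Cons a as')
  then have "x \<preceq> a" if "x \<in> set as" for x
    using that assms desc_hd unfolding Sq_in_OT_iff by blast
  then show ?thesis
    using Cons Sq_Cons_prec_principal[OF assms(2)] preceq_prec_trans[of _ a p] by auto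
qed

lemmas prec_Om_iff = Sq_prec_principal_iff[of _ Om, simplified]

lemma Sq_in_seg_Om_iff: "Sq as \<in> OT \<Longrightarrow> Sq as \<in> seg Om \<longleftrightarrow> set as \<subseteq> seg Om"
  using prec_Om_iff[of as] Sq_in_OT_iff[of as] unfolding seg_def by blast

section \<open>Accessible parts of the order\<close>

inductive_set accpart :: "oterm set \<Rightarrow> oterm set" for S where
  accpartI: "a \<in> S \<Longrightarrow> (\<And>b. b \<in> S \<Longrightarrow> b \<prec> a \<Longrightarrow> b \<in> accpart S) \<Longrightarrow> a \<in> accpart S"

lemma accpart_subset: "a \<in> accpart S \<Longrightarrow> a \<in> S"
  by (erule accpart.cases) simp

lemma accpart_down: "a \<in> accpart S \<Longrightarrow> b \<in> S \<Longrightarrow> b \<preceq> a \<Longrightarrow> b \<in> accpart S"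
  by (erule accpart.cases) (metis accpartI)

text \<open>The relational form of accessibility, as needed for the multiset extension in
  \<open>wf_mult\<close>.\<close>

lemma wf_accpart: "wf {(a, b). a \<in> accpart S \<and> b \<in> accpart S \<and> a \<prec> b}" (is "wf ?R")
proof (rule wfI_pf)
  fix A assume A: "A \<subseteq> ?R `` A"
  have "x \<notin> A" if "x \<in> accpart S" for x
    using that
  proof induction
    case (accpartI a)
    show ?case
    proof
      assume "a \<in> A"
      then have "a \<in> ?R `` A" using A by (rule subsetD[rotated])
      then obtain b where "b \<in> A" "b \<in> accpart S" "b \<prec> a" by auto
      then show False using accpartI accpart_subset by blast
    qed
  qed
  then show "A = {}" using A by blast
qed

text \<open>Past the common prefix, which cancels, the first entry \<open>b\<close> lies below
  \<open>a\<close>. By descent so do all remaining entries of \<open>bs\<close>, and they may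
  replace the remaining entries of \<open>as\<close> in the multiset order.\<close>

lemma desc_mult:
  assumes "Sq bs \<prec> Sq as" "desc bs" "set as \<subseteq> W" "set bs \<subseteq> W"
  shows "(mset bs, mset as) \<in> mult {(a, b). a \<in> W \<and> b \<in> W \<and> a \<prec> b}" (is "_ \<in> mult ?R")
  using assms
proof (induction bs arbitrary: as)
  case Nil
  then have "as \<noteq> []" by auto
  then show ?case using one_step_implies_mult[of "mset as" "{#}" ?R "{#}"] by simp
next
  case (Cons b bs)
  then obtain a as' where as: "as = a # as'" by (cases as) auto
  show ?case
  proof (cases "b \<prec> a")
    case True
    have "x \<prec> a" if "x \<in> set (b # bs)" for x
      using desc_hd[OF Cons.prems(2) that] True preceq_prec_trans by blast
    then have "({#} + mset (b # bs), {#} + mset as) \<in> mult ?R"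
      by (intro one_step_implies_mult) (use Cons.prems as in \<open>auto intro!: bexI[of _ a]\<close>)
    then show ?thesis by simp
  next
    case False
    then have "b = a" "(mset bs, mset as') \<in> mult ?R"
      using Cons.prems Cons.IH[of as'] as by auto
    moreover have "trans ?R" by (rule transI) (auto intro: prec_trans)
    moreover have "irrefl_on {a} ?R" by (simp add: irrefl_on_def)
    ultimately show ?thesis using mult_cancel_add_mset[of ?R a "mset bs" "mset as'"] as by simp
  qed
qed

text \<open>Well-founded induction on the multiset of entries. A principal predecessor is at most
  the first entry of \<open>as\<close>, hence accessible. For a sequence below \<open>Sq as\<close>
  the same holds of all its entries, and \<open>desc_mult\<close> makes its multiset
  smaller.\<close>

lemma accpart_Sq:
  assumes S: "S \<subseteq> OT" "\<And>as. Sq as \<in> OT \<Longrightarrow> Sq as \<in> S \<longleftrightarrow> set as \<subseteq> S"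
    and "set as \<subseteq> accpart S" "Sq as \<in> OT"
  shows "Sq as \<in> accpart S"
proof -
  let ?R = "mult {(a, b). a \<in> accpart S \<and> b \<in> accpart S \<and> a \<prec> b}"
  have "wf ?R" by (intro wf_mult wf_accpart)
  then show ?thesis using assms(3,4)
  proof (induction "mset as" arbitrary: as rule: wf_induct_rule)
    case less
    show ?case
    proof (rule accpartI)
      show "Sq as \<in> S" using less.prems S accpart_subset by blast
    next
      fix b assume b: "b \<in> S" "b \<prec> Sq as"
      then obtain a as' where as: "as = a # as'" by (cases as) auto
      show "b \<in> accpart S"
      proof (cases "principal b")
        case True
        then have "b \<preceq> a" using b as prec_Sq_Cons_principal by blast
        then show ?thesis using accpart_down less.prems as b by auto
      next
        case False
        then obtain bs where bs: "b = Sq bs" by (cases b) auto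
        have OT: "Sq bs \<in> OT" using b S bs by auto
        have sub: "set bs \<subseteq> accpart S"
        proof (cases bs)
          case (Cons b0 bs')
          have "x \<preceq> a" if "x \<in> set bs" for x
            using that desc_hd[of b0 bs' x] OT b bs as Cons preceq_trans[of x b0 a]
            unfolding Sq_in_OT_iff by auto
          then show ?thesis using accpart_down less.prems as b bs S(2)[OF OT] by fastforce
        qed simp
        have "(mset bs, mset as) \<in> ?R"
          by (rule desc_mult) (use b bs OT sub less.prems in \<open>auto simp: Sq_in_OT_iff\<close>)
        then show ?thesis using less.hyps sub OT bs by blast
      qed
    qed
  qed
qed

lemma Eset_subset_accpart: "a \<in> OT \<Longrightarrow> Eset a \<subseteq> accpart (seg Om)"
proof -
  define W where "W = accpart (seg Om)"
  define M where "M = {a \<in> OT. Eset a \<subseteq> W}"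
  define V where "V = accpart M"
  have W_Sq: "Sq as \<in> W" if "set as \<subseteq> W" "Sq as \<in> OT" for as
    unfolding W_def
    by (rule accpart_Sq[OF _ Sq_in_seg_Om_iff]) (use that in \<open>auto simp: seg_def W_def\<close>)
  have V_Sq: "Sq as \<in> V" if "set as \<subseteq> V" "Sq as \<in> OT" for as
    unfolding V_def
  proof (rule accpart_Sq)
    show "Sq bs \<in> M \<longleftrightarrow> set bs \<subseteq> M" if "Sq bs \<in> OT" for bs
      using that Sq_in_OT_iff[of bs] unfolding M_def by auto
  qed (use that in \<open>auto simp: M_def V_def\<close>)
  have M_Om: "a \<in> W" if "a \<in> OT" "a \<prec> Om" "Eset a \<subseteq> W" for a
    using that
  proof (induction rule: OT_induct)
    case (Sq as)
    then show ?case by (intro W_Sq) (auto simp: prec_Om_iff)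
  qed auto
  \<comment> \<open>A predecessor of \<open>a\<close> in \<open>M\<close> is again below \<Omega>,
    so the induction over \<open>seg Om\<close> covers it. That \<open>a\<close> is in
    \<open>M\<close> holds because the elements of \<open>Eset a\<close> are at most
    \<open>a\<close> and inherit accessibility.\<close>
  have W_V: "a \<in> V" if "a \<in> W" for a
    using that unfolding W_def
  proof induction
    case (accpartI a)
    have aW: "a \<in> W" unfolding W_def by (rule accpart.intros) (use accpartI in auto)
    have "a \<in> OT" "a \<prec> Om" using accpartI by (auto simp: seg_def)
    have "e \<in> W" if "e \<in> Eset a" for e
      using accpart_down[of a "seg Om" e] aW Eset_OT[OF \<open>a \<in> OT\<close> that] Eset_le[OF \<open>a \<in> OT\<close> that]
        preceq_prec_trans[of e a Om] \<open>a \<prec> Om\<close> by (auto simp: W_def seg_def)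
    then have "a \<in> M" using \<open>a \<in> OT\<close> by (auto simp: M_def)
    then show ?case unfolding V_def
      by (rule accpart.intros)
        (use accpartI prec_trans[OF _ \<open>a \<prec> Om\<close>] in \<open>auto simp: V_def M_def seg_def\<close>)
  qed
  \<comment> \<open>Outer induction on accessibility in \<open>M\<close>, inner induction on size.
    If \<open>Th b \<prec> Th a\<close> holds by comparison of arguments, the inner hypothesis puts
    \<open>Eset b\<close> into \<open>W\<close>, so \<open>b\<close> is in \<open>M\<close> and the
    outer hypothesis applies. Otherwise \<open>Th b\<close> is bounded by an element of
    \<open>Eset a\<close>, which lies in \<open>W\<close>.\<close>
  have V_Th: "Th a \<in> W" if "a \<in> V" for a
    using that unfolding V_def
  proof induction
    case (accpartI a)
    have aM: "a \<in> OT" "Eset a \<subseteq> W" using accpartI by (auto simp: M_def)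
    have below: "c \<in> W" if "c \<in> OT" "c \<prec> Th a" for c
      using that
    proof (induction "size c" arbitrary: c rule: less_induct)
      case less
      show ?case
      proof (cases c)
        case (Th b)
        show ?thesis
        proof (cases "\<exists>e\<in>Eset a. c \<preceq> e")
          case True
          then obtain e where e: "e \<in> Eset a" "c \<preceq> e" by blast
          then show ?thesis using accpart_down[of e "seg Om" c] aM less.prems Th
            by (auto simp: W_def seg_def)
        next
          case False
          then have b: "b \<prec> a" "\<And>e. e \<in> Eset b \<Longrightarrow> e \<prec> Th a" using less.prems Th by auto
          have bOT: "b \<in> OT" using Th less.prems by simp
          have "e \<in> W" if "e \<in> Eset b" for e
            using less.hyps[of e] size_Eset_Th[OF that] Th Eset_OT[OF bOT that] b(2)[OF that] by auto
          then have "b \<in> M" using bOT by (auto simp: M_def)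
          then show ?thesis using accpartI b Th by auto
        qed
      next
        case (Sq cs)
        have "x \<in> W" if x: "x \<in> set cs" for x
          using less.hyps[of x] size_list_estimation'[OF x order_refl, of size] Sq less.prems x
          by (auto simp: Sq_prec_principal_iff) (auto simp: Sq_in_OT_iff)
        then show ?thesis using W_Sq less.prems Sq by auto
      qed (use less in auto)
    qed
    show ?case unfolding W_def
      by (rule accpart.intros) (use aM below in \<open>auto simp: seg_def W_def\<close>)
  qed
  \<comment> \<open>Every member of \<open>M\<close> below \<Omega> is in \<open>W\<close> by
    \<open>M_Om\<close>, hence in \<open>V\<close> by \<open>W_V\<close>.\<close>
  have OmV: "Om \<in> V" unfolding V_def
    by (rule accpart.intros) (use M_Om W_V in \<open>auto simp: M_def V_def\<close>)
  \<comment> \<open>The second conjunct is carried along because \<open>V_Th\<close> needs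
    \<open>a \<in> V\<close> to place \<open>Th a\<close> in \<open>W\<close>.\<close>
  have "Eset a \<subseteq> W \<and> a \<in> V" if "a \<in> OT" for a
    using that
  proof (induction rule: OT_induct)
    case (Sq as)
    then show ?case using V_Sq by auto
  qed (use OmV V_Th W_V in auto)
  then show "a \<in> OT \<Longrightarrow> Eset a \<subseteq> accpart (seg Om)" unfolding W_def by blast
qed

lemma seg_Om_subset_accpart: "seg Om \<subseteq> accpart (seg Om)"
proof -
  have "a \<in> accpart (seg Om)" if "a \<in> OT" "a \<prec> Om" for a
    using that
  proof (induction rule: OT_induct)
    case (Th a)
    then show ?case using Eset_subset_accpart[of "Th a"] by simp
  next
    case (Sq as)
    then show ?case
      by (intro accpart_Sq[OF _ Sq_in_seg_Om_iff]) (auto simp: prec_Om_iff seg_def)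
  qed simp
  then show ?thesis by (auto simp: seg_def)
qed

lemma seg_Om_induct [consumes 2, case_names less]:
  assumes "a \<in> OT" "a \<prec> Om"
    and "\<And>a. a \<in> OT \<Longrightarrow> a \<prec> Om \<Longrightarrow> (\<And>b. b \<in> OT \<Longrightarrow> b \<prec> a \<Longrightarrow> P b) \<Longrightarrow> P a"
  shows "P a"
proof -
  have "a \<in> accpart (seg Om)" using assms seg_Om_subset_accpart by (auto simp: seg_def)
  then show ?thesis
  proof induction
    case (accpartI a)
    then show ?case using assms(3)[of a] prec_trans[of _ a Om] by (auto simp: seg_def)
  qed
qed

subsection \<open>Arithmetic\<close>

lemma entries_principal: "principal p \<Longrightarrow> entries p = [p]"
  by (cases p) auto

lemma entries_mk_seq [simp]: "entries (mk_seq as) = as"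
  by (auto simp: mk_seq_def length_Suc_conv entries_principal)

lemma mk_seq_entries: "a \<in> OT \<Longrightarrow> mk_seq (entries a) = a"
  by (cases a) (auto simp: mk_seq_def Sq_in_OT_iff)

lemma entries_OT: "a \<in> OT \<Longrightarrow> x \<in> set (entries a) \<Longrightarrow> x \<in> OT"
  by (cases a) (auto simp: Sq_in_OT_iff)

lemma desc_entries: "a \<in> OT \<Longrightarrow> desc (entries a)"
  by (cases a) (auto simp: Sq_in_OT_iff)

lemma mk_seq_OT: "set as \<subseteq> OT \<Longrightarrow> desc as \<Longrightarrow> mk_seq as \<in> OT"
  by (cases "length as = 1 \<and> principal (hd as)")
    (auto simp: mk_seq_def Sq_in_OT_iff length_Suc_conv)

lemma entries_inj: "a \<in> OT \<Longrightarrow> b \<in> OT \<Longrightarrow> entries a = entries b \<Longrightarrow> a = b"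
  by (metis mk_seq_entries)

lemma mk_seq_cases:
  obtains (principal) p where "as = [p]" "principal p" "mk_seq as = p"
  | (Nil) "as = []" "mk_seq as = Sq []"
  | (Cons) a as' where "as = a # as'" "mk_seq as = Sq as" "as' = [] \<longrightarrow> \<not> principal a"
  by (cases as; cases "tl as = [] \<and> principal (hd as)") (auto simp: mk_seq_def)

text \<open>Identifying a principal \<open>p\<close> with its one-entry sequence respects the order.
  Comparisons can thus be made on raw lists, even though \<open>Sq [p]\<close> is not in
  \<open>OT\<close>.\<close>

lemma mk_seq_prec_mk_seq [simp]: "mk_seq as \<prec> mk_seq bs \<longleftrightarrow> Sq as \<prec> Sq bs"
  by (cases as rule: mk_seq_cases; cases bs rule: mk_seq_cases)
    (auto simp: prec_Sq_Cons_principal Sq_Cons_prec_principal)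

lemma prec_iff_entries:
  assumes "a \<in> OT" "b \<in> OT"
  shows "a \<prec> b \<longleftrightarrow> Sq (entries a) \<prec> Sq (entries b)"
  using mk_seq_prec_mk_seq[of "entries a" "entries b"] assms by (simp add: mk_seq_entries)

lemma Eset_mk_seq [simp]: "Eset (mk_seq as) = \<Union> (Eset ` set as)"
  by (auto simp: mk_seq_def length_Suc_conv)

lemma Eset_entries [simp]: "\<Union> (Eset ` set (entries a)) = Eset a"
  by (cases a) auto

lemma entries_prec_Om: "a \<in> OT \<Longrightarrow> a \<prec> Om \<Longrightarrow> x \<in> set (entries a) \<Longrightarrow> x \<prec> Om"
  by (cases a) (auto simp: prec_Om_iff)

lemma mk_seq_prec_Om: "(\<And>a. a \<in> set as \<Longrightarrow> a \<prec> Om) \<Longrightarrow> mk_seq as \<prec> Om"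
  by (cases as) (auto simp: mk_seq_def)

lemma Sq_append_prec [simp]: "Sq (cs @ as) \<prec> Sq (cs @ bs) \<longleftrightarrow> Sq as \<prec> Sq bs"
  by (induction cs) auto

text \<open>In a descending list the entries at least as large as the head of \<open>b\<close> form
  an initial segment, and the greatest \<open>k\<close> of the definition is its length.\<close>

lemma oadd_eq:
  assumes "desc (entries a)"
  shows "a \<oplus> b = mk_seq (takeWhile (\<lambda>x. entries b = [] \<or> hd (entries b) \<preceq> x) (entries a) @ entries b)"
proof (cases "entries b = []")
  case True
  then show ?thesis by (simp add: oadd_def takeWhile_eq_all_conv[THEN iffD2])
next
  case False
  define as where "as = entries a"
  define h where "h = hd (entries b)"
  define n where "n = length (takeWhile (\<lambda>x. h \<preceq> x) as)"
  have "(GREATEST k. k \<le> length as \<and> (k = 0 \<or> h \<preceq> as ! (k - 1))) = n"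
  proof (rule Greatest_equality, goal_cases)
    case 1
    have "h \<preceq> as ! (n - 1)" if "n \<noteq> 0"
    proof -
      have less: "n - 1 < length (takeWhile (\<lambda>x. h \<preceq> x) as)" using that unfolding n_def by linarith
      have "as ! (n - 1) \<in> set (takeWhile (\<lambda>x. h \<preceq> x) as)"
        using nth_mem[OF less] unfolding takeWhile_nth[OF less] .
      then show ?thesis by (rule set_takeWhileD[THEN conjunct2])
    qed
    then show ?case using length_takeWhile_le[of _ as] by (auto simp: n_def)
  next
    case (2 k)
    show ?case
    proof (rule ccontr)
      assume "\<not> k \<le> n"
      then have k: "n < length as" "n \<le> k - 1" "k - 1 < length as" "h \<preceq> as ! (k - 1)" using 2 by auto
      have "as ! (k - 1) \<preceq> as ! n"
        using sorted_wrt_nth_less[OF assms[folded as_def], of n "k - 1"] k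
        by (cases "n = k - 1") auto
      then have "h \<preceq> as ! n" using k(4) preceq_trans by blast
      then show False using nth_length_takeWhile[of "\<lambda>x. h \<preceq> x" as] k(1) by (simp add: n_def)
    qed
  qed
  then show ?thesis using False
    by (simp add: oadd_def as_def[symmetric] h_def[symmetric] n_def takeWhile_eq_take[symmetric])
qed

lemma oadd_all:
  assumes "desc (entries a)" "\<And>x. x \<in> set (entries a) \<Longrightarrow> entries b \<noteq> [] \<Longrightarrow> hd (entries b) \<preceq> x"
  shows "a \<oplus> b = mk_seq (entries a @ entries b)"
proof -
  have "takeWhile (\<lambda>x. entries b = [] \<or> hd (entries b) \<preceq> x) (entries a) = entries a"
    unfolding takeWhile_eq_all_conv using assms(2) by blast
  then show ?thesis unfolding oadd_eq[OF assms(1), of b] by (rule arg_cong)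
qed

text \<open>Otherwise the simplifier rewrites \<^term>\<open>onum 1\<close> to \<^term>\<open>onum (Suc 0)\<close>.\<close>

declare One_nat_def [simp del]

lemma onum_1: "onum 1 = Sq [Sq []]"
  by (simp add: onum_def One_nat_def)

lemma oadd_one: "a \<in> OT \<Longrightarrow> a \<oplus> onum 1 = mk_seq (entries a @ [Sq []])"
  by (subst oadd_all) (auto simp: desc_entries onum_1)

lemma oadd_one_OT: "a \<in> OT \<Longrightarrow> a \<oplus> onum 1 \<in> OT"
  unfolding oadd_one
  by (rule mk_seq_OT) (auto simp: desc_entries entries_OT sorted_wrt_append)

lemma prec_oadd_one: "a \<in> OT \<Longrightarrow> a \<prec> a \<oplus> onum 1"
  using Sq_append_prec[of "entries a" "[]" "[Sq []]"] prec_iff_entries[of a "a \<oplus> onum 1"]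
    oadd_one_OT[of a] by (simp add: oadd_one)

lemma Eset_oadd_one [simp]: "a \<in> OT \<Longrightarrow> Eset (a \<oplus> onum 1) = Eset a"
  by (simp add: oadd_one)

text \<open>A left summand 1 is absorbed unless \<open>a\<close> is 0 or its first exponent is 0,
  which for genuine terms means that \<open>a\<close> is finite.\<close>

lemma one_oadd:
  "onum 1 \<oplus> a = mk_seq ((if entries a = [] \<or> hd (entries a) = Sq [] then [Sq []] else []) @ entries a)"
  by (subst oadd_eq) (auto simp: onum_1)

lemma one_oadd_OT:
  assumes "a \<in> OT"
  shows "onum 1 \<oplus> a \<in> OT"
proof -
  have "desc (Sq [] # entries a)" if "entries a = [] \<or> hd (entries a) = Sq []"
    using that desc_entries[OF assms] by (cases "entries a") auto
  moreover have "set (entries a) \<subseteq> OT" using entries_OT[OF assms] by blast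
  ultimately show ?thesis
    unfolding one_oadd using desc_entries[OF assms]
    by (cases "entries a = [] \<or> hd (entries a) = Sq []") (auto intro!: mk_seq_OT)
qed

lemma one_oadd_neq_0 [simp]: "onum 1 \<oplus> a \<noteq> Sq []"
proof
  assume "onum 1 \<oplus> a = Sq []"
  then have "entries (onum 1 \<oplus> a) = []" by simp
  then show False by (auto simp: one_oadd split: if_splits)
qed

lemma one_oadd_mono:
  assumes "a \<in> OT" "b \<in> OT" "a \<prec> b"
  shows "onum 1 \<oplus> a \<prec> onum 1 \<oplus> b"
proof -
  have "Sq (entries a) \<prec> Sq (entries b)" using assms prec_iff_entries by blast
  then show ?thesis unfolding one_oadd mk_seq_prec_mk_seq
    by (cases "entries a"; cases "entries b") auto
qed

lemma Eset_one_oadd [simp]: "Eset (onum 1 \<oplus> a) = Eset a"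
  unfolding one_oadd Eset_mk_seq by auto

text \<open>The separate clauses for \<open>Om\<close> and \<open>Th\<close> agree with the one for
  sequences, because principal exponents absorb a left summand 1.\<close>

lemma omega_times_eq: "omega_times a = mk_seq (map (\<lambda>x. onum 1 \<oplus> x) (entries a))"
  by (cases a) (auto simp: one_oadd mk_seq_def)

lemma omega_times_OT:
  assumes "a \<in> OT"
  shows "omega_times a \<in> OT"
proof -
  have "desc (map (\<lambda>x. onum 1 \<oplus> x) (entries a))"
    unfolding sorted_wrt_map
    by (rule sorted_wrt_mono_rel[OF _ desc_entries[OF assms]])
      (use one_oadd_mono entries_OT[OF assms] in blast)
  then show ?thesis unfolding omega_times_eq
    by (intro mk_seq_OT) (use one_oadd_OT entries_OT[OF assms] in auto)
qed

lemma Sq_map_prec: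
  assumes "\<And>x y. x \<in> set as \<Longrightarrow> y \<in> set bs \<Longrightarrow> x \<prec> y \<Longrightarrow> g x \<prec> g y" "Sq as \<prec> Sq bs"
  shows "Sq (map g as) \<prec> Sq (map g bs)"
  using assms
proof (induction as arbitrary: bs)
  case Nil
  then show ?case by (cases bs) auto
next
  case (Cons a as)
  then show ?case by (cases bs) auto
qed

lemma omega_times_mono:
  assumes "a \<in> OT" "b \<in> OT" "a \<prec> b"
  shows "omega_times a \<prec> omega_times b"
  unfolding omega_times_eq mk_seq_prec_mk_seq
  by (rule Sq_map_prec) (use assms prec_iff_entries one_oadd_mono entries_OT[OF assms(1)] entries_OT[OF assms(2)] in auto)

lemma Eset_omega_times [simp]: "Eset (omega_times a) = Eset a"
  by (simp add: omega_times_eq)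

text \<open>Nonzero multiples of \<omega> are limits: their exponents have the form 1 +
  \<open>y\<close> and so differ from 0, and appending a 0 to a smaller list does not reach
  them.\<close>

lemma prec_omega_times_succ:
  assumes "x \<in> OT" "a \<in> OT" "x \<prec> omega_times a"
  shows "x \<oplus> onum 1 \<prec> omega_times a"
proof -
  have "Sq (xs @ [Sq []]) \<prec> Sq ys" if "Sq xs \<prec> Sq ys" "Sq [] \<notin> set ys" for xs ys
    using that
  proof (induction xs arbitrary: ys)
    case Nil
    then show ?case by (cases ys) auto
  next
    case (Cons x xs)
    then show ?case by (cases ys) auto
  qed
  from this[of "entries x" "entries (omega_times a)"] show ?thesis
    using assms prec_iff_entries[of x "omega_times a"]
      prec_iff_entries[of "x \<oplus> onum 1" "omega_times a"]
    by (simp add: omega_times_OT oadd_one_OT)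
      (simp add: oadd_one omega_times_eq image_iff one_oadd_neq_0[symmetric])
qed

lemma zero_prec_omega_times: "a \<noteq> Sq [] \<Longrightarrow> a \<in> OT \<Longrightarrow> Sq [] \<prec> omega_times a"
proof -
  assume a: "a \<noteq> Sq []" "a \<in> OT"
  have "entries (omega_times a) \<noteq> []" using a by (cases a) (auto simp: omega_times_eq)
  then show ?thesis by auto
qed

section \<open>Numerals\<close>

lemma prec_Sq_one: "x \<prec> Sq [Sq []] \<longleftrightarrow> x = Sq []"
proof (cases x)
  case (Sq xs)
  then show ?thesis by (cases xs) auto
qed auto

lemma seg_oomega:
  assumes "c \<in> seg oomega"
  obtains n where "c = onum n"
proof -
  have c: "c \<in> OT" "c \<prec> Sq [Sq [Sq []]]"
    using assms by (auto simp: seg_def oomega_def onum_1)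
  then obtain cs where cs: "c = Sq cs" by (cases c) auto
  have "x = Sq []" if "x \<in> set cs" for x
  proof (cases cs)
    case (Cons c0 cs')
    then have "c0 = Sq []" using c cs prec_Sq_one by auto
    then show ?thesis
      using c(1)[unfolded cs Cons Sq_in_OT_iff] Cons that desc_hd[of c0 cs' x] by auto
  qed (use that in simp)
  then have "cs = replicate (length cs) (Sq [])" by (simp add: replicate_length_same)
  then show ?thesis using that cs unfolding onum_def by metis
qed

lemma onum_prec_iff [simp]: "onum m \<prec> onum n \<longleftrightarrow> m < n"
proof (induction m arbitrary: n)
  case 0
  then show ?case by (cases n) (auto simp: onum_def)
next
  case (Suc m)
  then show ?case by (cases n) (auto simp: onum_def)
qed

lemma seg_onum_2: "c \<in> seg (onum 2) \<Longrightarrow> c = onum 0 \<or> c = onum 1"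
proof -
  assume c: "c \<in> seg (onum 2)"
  have "onum 2 \<prec> oomega" by (simp add: onum_def oomega_def numeral_2_eq_2)
  then have "c \<in> seg oomega" using c prec_trans by (auto simp: seg_def)
  then obtain n where "c = onum n" by (rule seg_oomega)
  moreover have "n < 2" using c calculation by (simp add: seg_def)
  ultimately show ?thesis by (auto simp: less_2_cases_iff One_nat_def)
qed

subsection \<open>The function \<open>phibar\<close>\<close>

text \<open>The sum of \<Omega> and \<open>c\<close> without absorption. It is correct for
  \<open>c \<preceq> Om\<close>, where all entries of \<open>c\<close> are at most \<Omega>.\<close>

definition Om_plus :: "oterm \<Rightarrow> oterm" where
  "Om_plus c = mk_seq (Om # entries c)"

text \<open>The term \<open>\<Omega>\<cdot>a + b\<close> as a plain concatenation. By
  \<open>phibar_eq\<close> this is correct for \<open>a\<close> and \<open>b\<close> below \<Omega>: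
  every \<open>\<Omega> + a\<^sub>i\<close> then exceeds all entries of \<open>b\<close>.\<close>

definition phi_arg :: "oterm \<Rightarrow> oterm \<Rightarrow> oterm" where
  "phi_arg a b = mk_seq (map Om_plus (entries a) @ entries b)"

lemma Om_oadd: "c \<in> OT \<Longrightarrow> c \<preceq> Om \<Longrightarrow> Om \<oplus> c = Om_plus c"
  unfolding Om_plus_def
  by (subst oadd_all) (auto dest: entries_prec_Om[OF _ _ hd_in_set])

lemma Om_plus_mono: "c \<in> OT \<Longrightarrow> d \<in> OT \<Longrightarrow> c \<prec> d \<Longrightarrow> Om_plus c \<prec> Om_plus d"
  by (simp add: Om_plus_def prec_iff_entries)

lemma Om_le_Om_plus: "Om \<preceq> Om_plus c"
proof -
  have "Om \<preceq> mk_seq (Om # l)" for l by (cases l) (auto simp: mk_seq_def)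
  then show ?thesis by (simp add: Om_plus_def)
qed

lemma Om_plus_OT:
  assumes "c \<in> OT" "c \<prec> Om"
  shows "Om_plus c \<in> OT"
  unfolding Om_plus_def
  by (rule mk_seq_OT) (use assms entries_OT[OF assms(1)] entries_prec_Om[OF assms] desc_entries in auto)

lemma Eset_Om_plus [simp]: "Eset (Om_plus c) = Eset c"
  by (simp add: Om_plus_def)

lemma Eset_phi_arg [simp]: "Eset (phi_arg a b) = Eset a \<union> Eset b"
  by (simp add: phi_arg_def image_Un)

lemma prec_Om_plus: "x \<prec> Om \<Longrightarrow> x \<prec> Om_plus c"
  using Om_le_Om_plus prec_preceq_trans by blast

lemma desc_map_Om_plus:
  assumes "a \<in> OT"
  shows "desc (map Om_plus (entries a))"
  unfolding sorted_wrt_map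
  by (rule sorted_wrt_mono_rel[OF _ desc_entries[OF assms]])
    (use Om_plus_mono entries_OT[OF assms] in blast)

lemma phi_arg_OT:
  assumes "a \<in> OT" "a \<prec> Om" "b \<in> OT" "b \<prec> Om"
  shows "phi_arg a b \<in> OT"
  unfolding phi_arg_def
proof (rule mk_seq_OT)
  show "set (map Om_plus (entries a) @ entries b) \<subseteq> OT"
    using entries_prec_Om[OF assms(1,2)] entries_OT[OF assms(1)] entries_OT[OF assms(3)]
    by (auto intro: Om_plus_OT)
  show "desc (map Om_plus (entries a) @ entries b)"
    unfolding sorted_wrt_append
    using desc_map_Om_plus[OF assms(1)] desc_entries[OF assms(3)]
      prec_Om_plus[OF entries_prec_Om[OF assms(3,4)]] by auto
qed

lemma phibar_eq:
  assumes "a \<in> OT" "a \<prec> Om" "b \<in> OT" "b \<prec> Om"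
  shows "phibar a b = Th (phi_arg a b)"
proof -
  have "Omega_times a = mk_seq (map Om_plus (entries a))"
    unfolding Omega_times_def
    by (rule arg_cong[where f = mk_seq], rule map_cong)
      (use entries_OT[OF assms(1)] entries_prec_Om[OF assms(1,2)] Om_oadd in auto)
  moreover have "hd (entries b) \<preceq> x"
    if "x \<in> set (map Om_plus (entries a))" "entries b \<noteq> []" for x
    using that prec_Om_plus entries_prec_Om[OF assms(3,4)] by auto
  ultimately have "Omega_times a \<oplus> b = phi_arg a b"
    unfolding phi_arg_def using desc_map_Om_plus[OF assms(1)] by (subst oadd_all) auto
  then show ?thesis by (simp add: phibar_def)
qed

lemma Omega_times_Om: "Omega_times Om = mk_seq [Om_plus Om]"
  by (simp add: Omega_times_def Om_oadd)

text \<open>All entries lie below \<Omega> + \<Omega>, the single exponent of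
  \<open>\<Omega>\<^sup>2\<close>. This bound makes \<vartheta> of the argument available in
  \<open>Hop\<close>.\<close>

lemma phi_arg_prec_Omega_square:
  assumes "a \<in> OT" "a \<prec> Om" "b \<in> OT" "b \<prec> Om"
  shows "phi_arg a b \<prec> Omega_times Om"
proof -
  have "x \<prec> Om_plus Om" if "x \<in> set (map Om_plus (entries a) @ entries b)" for x
    using that entries_prec_Om[OF assms(1,2)] entries_OT[OF assms(1)] entries_prec_Om[OF assms(3,4)]
    by (auto intro: Om_plus_mono prec_Om_plus)
  then show ?thesis unfolding Omega_times_Om phi_arg_def mk_seq_prec_mk_seq
    by (cases "map Om_plus (entries a) @ entries b") auto
qed

lemma phi_arg_mono_right:
  assumes "b \<in> OT" "c \<in> OT" "b \<prec> c"
  shows "phi_arg a b \<prec> phi_arg a c"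
  using assms by (simp add: phi_arg_def prec_iff_entries)

text \<open>The first difference between \<open>a\<close> and \<open>b\<close> decides. If
  \<open>a\<close> runs out first, the entries of \<open>c\<close>, all below \<Omega>, meet an
  exponent that is at least \<Omega>.\<close>

lemma phi_arg_mono_left:
  assumes "a \<in> OT" "b \<in> OT" "a \<prec> b" "c \<in> OT" "c \<prec> Om"
  shows "phi_arg a c \<prec> phi_arg b d"
proof -
  have "Sq (map Om_plus as @ entries c) \<prec> Sq (map Om_plus bs @ ds)"
    if "Sq as \<prec> Sq bs" "set as \<subseteq> OT" "set bs \<subseteq> OT" for as bs ds
    using that
  proof (induction as arbitrary: bs)
    case Nil
    then obtain b bs' where "bs = b # bs'" by (cases bs) auto
    then show ?case using prec_Om_plus[OF entries_prec_Om[OF assms(4,5)]]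
      by (cases "entries c") auto
  next
    case (Cons a as)
    then show ?case by (cases bs) (auto intro: Om_plus_mono)
  qed
  from this[of "entries a" "entries b" "entries d"] show ?thesis
    using assms(3) prec_iff_entries[OF assms(1,2)] entries_OT[OF assms(1)] entries_OT[OF assms(2)]
    unfolding phi_arg_def mk_seq_prec_mk_seq by auto
qed

text \<open>Following first entries downwards from \<open>a\<close> ends at a \<vartheta>-term that
  is at least \<open>Th x\<close>, since \<Omega> is excluded and 0 is too small.\<close>

lemma Th_le_Eset: "a \<in> OT \<Longrightarrow> a \<prec> Om \<Longrightarrow> Th x \<preceq> a \<Longrightarrow> \<exists>e\<in>Eset a. Th x \<preceq> e"
proof (induction rule: OT_induct)
  case (Sq as)
  then obtain a as' where as: "as = a # as'" by (cases as) auto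
  then have "Th x \<preceq> a" "a \<prec> Om" using Sq.prems by auto
  then show ?case using Sq.IH[of a] as by auto
qed auto

text \<open>A larger argument alone does not make \<vartheta> larger: the elements of the left
  \<open>Eset\<close> must also stay below. Those of \<open>Eset b\<close> are at most
  \<open>c\<close>, and \<open>Th_le_Eset\<close> bounds them by elements of
  \<open>Eset c\<close>.\<close>

lemma Th_phi_arg_mono_right:
  assumes "a \<in> OT" "b \<in> OT" "c \<in> OT" "c \<prec> Om" "b \<prec> c"
  shows "Th (phi_arg a b) \<prec> Th (phi_arg a c)"
proof -
  have "e \<prec> Th (phi_arg a c)" if e: "e \<in> Eset b" for e
  proof -
    have "e \<preceq> c" using Eset_le[OF assms(2) e] assms(5) preceq_prec_trans by blast
    then obtain f where "f \<in> Eset c" "e \<preceq> f"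
      using Th_le_Eset assms(3,4) Eset_is_Th[OF e] by metis
    then show ?thesis using Th_Eset[of f "phi_arg a c"] preceq_prec_trans[of e f] by auto
  qed
  moreover have "e \<prec> Th (phi_arg a c)" if e: "e \<in> Eset a" for e
    using Th_Eset[of e "phi_arg a c"] e by auto
  ultimately show ?thesis using phi_arg_mono_right[of b c a] assms by auto
qed

text \<open>The closure that keeps heights bounded when the main induction hypothesis is iterated.
  For \<open>a \<prec> b\<close> the argument drops whichever \<open>c\<close> below \<Omega> is
  added, so \<open>c\<close> may range over everything below the target itself.\<close>

lemma Th_phi_arg_mono_left:
  assumes "a \<in> OT" "b \<in> OT" "b \<prec> Om" "a \<prec> b" "c \<in> OT" "c \<prec> Th (phi_arg b d)"
  shows "Th (phi_arg a c) \<prec> Th (phi_arg b d)"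
proof -
  have "c \<prec> Om" using assms(6) prec_trans[of c "Th (phi_arg b d)" Om] by simp
  have "e \<prec> Th (phi_arg b d)" if e: "e \<in> Eset a" for e
  proof -
    have "e \<preceq> b" using Eset_le[OF assms(1) e] assms(4) preceq_prec_trans by blast
    then obtain f where "f \<in> Eset b" "e \<preceq> f"
      using Th_le_Eset assms(2,3) Eset_is_Th[OF e] by metis
    then show ?thesis using Th_Eset[of f "phi_arg b d"] preceq_prec_trans[of e f] by auto
  qed
  moreover have "e \<prec> Th (phi_arg b d)" if e: "e \<in> Eset c" for e
    using Eset_le[OF assms(5) e] assms(6) preceq_prec_trans by blast
  ultimately show ?thesis using phi_arg_mono_left[of a b c d] assms \<open>c \<prec> Om\<close> by auto
qed

lemma prec_Th_of_Eset: "a \<in> OT \<Longrightarrow> a \<prec> Om \<Longrightarrow> (\<And>e. e \<in> Eset a \<Longrightarrow> e \<prec> Th x) \<Longrightarrow> a \<prec> Th x"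
proof (induction rule: OT_induct)
  case (Th a)
  then show ?case by (metis Eset.simps(2) singletonI)
next
  case (Sq as)
  have "y \<prec> Th x" if "y \<in> set as" for y
    using Sq.IH[OF that] Sq.prems prec_Om_iff[OF Sq.hyps] that by auto
  then show ?case using Sq_prec_principal_iff[OF Sq.hyps, of "Th x"] by simp
qed simp

text \<open>Serves the side condition of (Disj), that the witness lies below the height, when the
  height \<open>b\<close> is replaced by the new one.\<close>

lemma prec_Th_phi_arg: "b \<in> OT \<Longrightarrow> b \<prec> Om \<Longrightarrow> b \<prec> Th (phi_arg a b)"
  using prec_Th_of_Eset[of b "phi_arg a b"] Th_Eset[of _ "phi_arg a b"] by auto

subsection \<open>Splitting cut ranks\<close>

text \<open>\<open>omega_of a\<close> is the power of \<omega> with exponent \<open>a\<close>: its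
  only entry is \<open>a\<close>, principal or not. Exactly the entries of \<open>r\<close> that are
  at least \<open>a\<close> survive, as \<open>entries r\<close> is descending.\<close>

lemma oadd_omega_of:
  assumes "r \<in> OT"
  shows "r \<oplus> omega_of a = mk_seq (takeWhile (\<lambda>x. a \<preceq> x) (entries r) @ [a])"
proof -
  have "entries (omega_of a) = [a]" by (auto simp: omega_of_def entries_principal)
  then show ?thesis using oadd_eq[OF desc_entries[OF assms], of "omega_of a"] by simp
qed

lemma oadd_omega_of_OT:
  assumes "r \<in> OT" "a \<in> OT"
  shows "r \<oplus> omega_of a \<in> OT"
  unfolding oadd_omega_of[OF assms(1)]
proof (rule mk_seq_OT)
  show "desc (takeWhile (\<lambda>x. a \<preceq> x) (entries r) @ [a])"
    using sorted_wrt_takeWhile[OF desc_entries[OF assms(1)], of "\<lambda>x. a \<preceq> x"]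
    by (auto simp: sorted_wrt_append dest: set_takeWhileD)
qed (use assms entries_OT[OF assms(1)] in \<open>auto dest: set_takeWhileD\<close>)

lemma oadd_omega_of_prec_Om:
  assumes "r \<in> OT" "r \<prec> Om" "a \<prec> Om"
  shows "r \<oplus> omega_of a \<prec> Om"
  unfolding oadd_omega_of[OF assms(1)]
  by (rule mk_seq_prec_Om) (use assms entries_prec_Om[OF assms(1,2)] in \<open>auto dest: set_takeWhileD\<close>)

text \<open>A difference within \<open>r\<close>, or an end of \<open>s\<close> inside it, would
  decide both comparisons alike, so \<open>s\<close> has to start with all of
  \<open>r\<close>.\<close>

lemma Sq_prec_split:
  assumes "Sq s \<prec> Sq (r @ v)" "\<not> Sq s \<prec> Sq (r @ u)"
  obtains t where "s = r @ t" "Sq t \<prec> Sq v" "\<not> Sq t \<prec> Sq u"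
proof -
  have "\<exists>t. s = r @ t \<and> Sq t \<prec> Sq v \<and> \<not> Sq t \<prec> Sq u"
    using assms
  proof (induction r arbitrary: s)
    case (Cons x r)
    then obtain y s' where s: "s = y # s'" by (cases s) auto
    then have "y = x" "Sq s' \<prec> Sq (r @ v)" "\<not> Sq s' \<prec> Sq (r @ u)" using Cons.prems by auto
    then show ?case using Cons.IH s by auto
  qed simp
  then show ?thesis using that by blast
qed

text \<open>Entrywise, \<open>t\<close> is bounded by \<open>v\<close> through \<open>m\<close>:
  either a strict inequality decides, or \<open>t\<close> is a proper initial segment.\<close>

lemma Sq_prec_of_length:
  assumes "\<And>x. x \<in> set t \<Longrightarrow> x \<preceq> m" "\<And>y. y \<in> set v \<Longrightarrow> m \<preceq> y" "length t < length v"
  shows "Sq t \<prec> Sq v"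
  using assms
proof (induction t arbitrary: v)
  case (Cons x t)
  then obtain y v' where v: "v = y # v'" by (cases v) auto
  have "x \<preceq> y" using Cons.prems(1)[of x] Cons.prems(2)[of y] v preceq_trans by auto
  then show ?case using Cons.IH[of v'] Cons.prems v by auto
qed auto

text \<open>Only the first addition can absorb entries of \<open>r\<close>; afterwards all remaining
  entries are at least \<open>a\<close>. Hence the count starts at \<open>Suc n\<close>.\<close>

lemma oadd_omega_of_funpow:
  assumes "r \<in> OT" "a \<in> OT"
  shows "((\<lambda>x. x \<oplus> omega_of a) ^^ Suc n) r =
    mk_seq (takeWhile (\<lambda>x. a \<preceq> x) (entries r) @ replicate (Suc n) a)"
proof (induction n)
  case 0
  then show ?case using oadd_omega_of[OF assms(1)] by simp
next
  case (Suc n)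
  let ?l = "takeWhile (\<lambda>x. a \<preceq> x) (entries r) @ replicate (Suc n) a"
  have OT: "((\<lambda>x. x \<oplus> omega_of a) ^^ k) r \<in> OT" for k
    by (induction k) (auto simp: assms oadd_omega_of_OT)
  have "((\<lambda>x. x \<oplus> omega_of a) ^^ Suc (Suc n)) r = mk_seq ?l \<oplus> omega_of a"
    using Suc by simp
  also have "\<dots> = mk_seq (takeWhile (\<lambda>x. a \<preceq> x) ?l @ [a])"
    using oadd_omega_of[OF OT[of "Suc n"], of a] Suc by simp
  also have "takeWhile (\<lambda>x. a \<preceq> x) ?l = ?l"
    unfolding takeWhile_eq_all_conv by (auto dest: set_takeWhileD)
  finally show ?case by (simp add: replicate_append_same)
qed

text \<open>In the second case, the exponent \<open>a'\<close> occurs in \<open>s\<close> and so is controlled by the parameters of \<open>s\<close>.\<close>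

lemma cut_rank_split:
  assumes r: "r \<in> OT" and s: "s \<in> OT" and a: "a \<in> OT"
    and less: "s \<prec> r \<oplus> omega_of a" and nless: "\<not> s \<prec> r"
  shows "s = r \<or> (\<exists>a' n. a' \<in> OT \<and> a' \<prec> a \<and> Eset a' \<subseteq> Eset s \<and>
    s \<prec> ((\<lambda>x. x \<oplus> omega_of a') ^^ n) r)"
proof -
  \<comment> \<open>\<open>r'\<close> is what survives of \<open>r\<close> when
    \<open>omega_of a\<close> is added, and \<open>u\<close> is what is absorbed. As
    \<open>s\<close> is below \<open>r' @ [a]\<close> but not below \<open>r' @ u\<close>, its
    entries begin with \<open>r'\<close>.\<close>
  define r' where "r' = takeWhile (\<lambda>x. a \<preceq> x) (entries r)"
  define u where "u = dropWhile (\<lambda>x. a \<preceq> x) (entries r)"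
  have er: "entries r = r' @ u" by (simp add: r'_def u_def)
  have less': "Sq (entries s) \<prec> Sq (r' @ [a])"
    using less prec_iff_entries[OF s oadd_omega_of_OT[OF r a]] by (simp add: oadd_omega_of r r'_def)
  have nless': "\<not> Sq (entries s) \<prec> Sq (r' @ u)" using nless prec_iff_entries[OF s r] er by simp
  obtain t where t: "entries s = r' @ t" "Sq t \<prec> Sq [a]" "\<not> Sq t \<prec> Sq u"
    using Sq_prec_split[OF less' nless'] by blast
  show ?thesis
  proof (cases t)
    case Nil
    then have "u = []" using t(3) by auto
    then show ?thesis using Nil t(1) er entries_inj[OF s r] by simp
  next
    \<comment> \<open>The exponent is the first entry of \<open>t\<close>. By descent no entry of
      \<open>t\<close> exceeds \<open>a'\<close>, so one more copy of \<open>a'\<close> than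
      \<open>t\<close> has entries suffices.\<close>
    case (Cons a' t')
    have "a' \<prec> a" using t(2) Cons by auto
    have a's: "a' \<in> set (entries s)" using t(1) Cons by simp
    have "a' \<in> OT" using entries_OT[OF s a's] .
    have sub: "Eset a' \<subseteq> Eset s" using a's Eset_entries[of s] by blast
    define w where "w = takeWhile (\<lambda>x. a' \<preceq> x) u"
    have "x \<in> set r' \<Longrightarrow> a' \<preceq> x" for x
      using \<open>a' \<prec> a\<close> prec_preceq_trans unfolding r'_def by (blast dest: set_takeWhileD)
    then have tw: "takeWhile (\<lambda>x. a' \<preceq> x) (entries r) = r' @ w"
      unfolding er w_def by (subst takeWhile_append2) auto
    have "desc (r' @ t)" using desc_entries[OF s] t(1) by simp
    then have "x \<preceq> a'" if "x \<in> set t" for x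
      using that Cons desc_hd[of a' t' x] by (auto simp: sorted_wrt_append)
    then have "Sq t \<prec> Sq (w @ replicate (Suc (length t)) a')"
      by (rule Sq_prec_of_length[where m = a']) (auto simp: w_def dest: set_takeWhileD)
    then have "s \<prec> ((\<lambda>x. x \<oplus> omega_of a') ^^ Suc (length t)) r"
      unfolding oadd_omega_of_funpow[OF r \<open>a' \<in> OT\<close>] tw
      using mk_seq_prec_mk_seq[of "entries s"] mk_seq_entries[OF s] t(1)
      by (metis Sq_append_prec append_assoc)
    then show ?thesis using \<open>a' \<prec> a\<close> \<open>a' \<in> OT\<close> sub by blast
  qed
qed

subsection \<open>Operators\<close>

lemma seg_OT: "c \<in> seg a \<Longrightarrow> c \<in> OT"
  by (simp add: seg_def)

text \<open>Together with \<open>Cset_of_Eset\<close> this shows that membership of a term in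
  \<open>Cset\<close> depends only on its \<open>Eset\<close>, a property that passes to the
  intersection \<open>Hop\<close>.\<close>

lemma Cset_Eset: "x \<in> Cset a b \<Longrightarrow> e \<in> Eset x \<Longrightarrow> e \<in> Cset a b"
proof (induction rule: Cset.induct)
  case (2 c)
  then have "e \<in> seg b"
    using Eset_OT[of c e] Eset_le[of c e] preceq_prec_trans[of e c b] by (simp add: seg_def)
  then show ?case by (rule Cset.intros)
next
  case (3 c)
  then show ?case using Cset.intros(3) by auto
qed auto

lemma Cset_of_Eset: "x \<in> OT \<Longrightarrow> Eset x \<subseteq> Cset a b \<Longrightarrow> x \<in> Cset a b"
proof (induction rule: OT_induct)
  case (Sq as)
  then show ?case by (intro Cset.intros(4)) auto
qed (auto intro: Cset.intros)

lemma Hop_iff: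
  "x \<in> Hop h X \<longleftrightarrow> x \<in> OT \<and>
    (\<forall>c d. c \<in> OT \<longrightarrow> d \<in> OT \<longrightarrow> h \<prec> c \<longrightarrow> X \<subseteq> Cset c d \<longrightarrow> x \<in> Cset c d)"
  by (auto simp: Hop_def)

lemma Hop_OT: "x \<in> Hop h X \<Longrightarrow> x \<in> OT"
  by (simp add: Hop_iff)

lemma Hop_mono: "X \<subseteq> Y \<Longrightarrow> Hop h X \<subseteq> Hop h Y"
  unfolding Hop_def by blast

lemma Hop_member: "c \<in> OT \<Longrightarrow> c \<in> X \<Longrightarrow> c \<in> Hop h X"
  unfolding Hop_def by blast

lemma Hop_Eset: "x \<in> Hop h X \<Longrightarrow> e \<in> Eset x \<Longrightarrow> e \<in> Hop h X"
  unfolding Hop_iff using Cset_Eset[of x _ _ e] Eset_OT[of x e] by blast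

lemma Hop_of_Eset: "x \<in> OT \<Longrightarrow> Eset x \<subseteq> Hop h X \<Longrightarrow> x \<in> Hop h X"
  unfolding Hop_iff subset_iff[of "Eset x"] using Cset_of_Eset[of x] by blast

text \<open>Every \<open>Cset c d\<close> in the intersection has \<open>h \<prec> c\<close>, so its
  closure clause for \<vartheta> reaches all arguments below \<open>h\<close>.\<close>

lemma Hop_Th:
  assumes "x \<in> Hop h X" "x \<prec> h"
  shows "Th x \<in> Hop h X"
proof -
  have "Th x \<in> Cset c d" if "c \<in> OT" "d \<in> OT" "h \<prec> c" "X \<subseteq> Cset c d" for c d
  proof (rule Cset.intros(3))
    show "x \<in> Cset c d" using assms(1) that unfolding Hop_iff by blast
    show "x \<prec> c" using assms(2) that(3) by (rule prec_trans)
  qed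
  then show ?thesis using Hop_OT[OF assms(1)] unfolding Hop_iff by simp
qed

lemma Hop_insert:
  assumes "c \<in> Hop h X"
  shows "Hop h (insert c X \<union> Y) = Hop h (X \<union> Y)"
proof
  show "Hop h (insert c X \<union> Y) \<subseteq> Hop h (X \<union> Y)"
  proof
    fix x assume x: "x \<in> Hop h (insert c X \<union> Y)"
    have "x \<in> Cset a b" if ab: "a \<in> OT" "b \<in> OT" "h \<prec> a" "X \<union> Y \<subseteq> Cset a b" for a b
    proof -
      have "c \<in> Cset a b" using assms ab unfolding Hop_iff by simp
      then show ?thesis using x ab unfolding Hop_iff by simp
    qed
    then show "x \<in> Hop h (X \<union> Y)" using x unfolding Hop_iff by simp
  qed
qed (rule Hop_mono, blast)

text \<open>The bound \<open>Omega_times Om \<preceq> h\<close> puts the argument of \<vartheta>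
  below the index of the operator, so that \<open>Hop_Th\<close> applies.\<close>

lemma Hop_phi_arg:
  assumes "a \<in> Hop h X" "a \<prec> Om" "b \<in> Hop h X" "b \<prec> Om" "Omega_times Om \<preceq> h"
  shows "Th (phi_arg a b) \<in> Hop h X"
proof (rule Hop_Th)
  show "phi_arg a b \<in> Hop h X"
    by (rule Hop_of_Eset) (use assms Hop_OT Hop_Eset phi_arg_OT in auto)
  show "phi_arg a b \<prec> h"
    using phi_arg_prec_Omega_square[of a b] assms Hop_OT
      prec_preceq_trans[of "phi_arg a b" "Omega_times Om" h] by blast
qed

lemma adjoin_Hop_empty [simp]: "adjoin (Hop h) X {} = Hop h X"
  by (simp add: adjoin_def)

lemma adjoin_adjoin_Hop [simp]: "adjoin (adjoin (Hop h) X) {c} = adjoin (Hop h) (insert c X)"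
  by (simp add: adjoin_def)

lemma adjoin_Hop_insert: "c \<in> Hop h X \<Longrightarrow> adjoin (Hop h) (insert c X) = adjoin (Hop h) X"
  using Hop_insert by (auto simp: adjoin_def)

subsection \<open>Sentences\<close>

lemma neg_neg [simp]: "neg (neg A) = A"
  by (induction A) auto

lemma set_fml_neg [simp]: "set_fml (neg A) = set_fml A"
  by (induction A) auto

lemma fv_neg [simp]: "fv (neg A) = fv A"
  by (induction A) auto

lemma rk_neg [simp]: "rk (neg A) = rk A"
  by (induction A) auto

lemma sentence_neg [simp]: "sentence (neg A) \<longleftrightarrow> sentence A"
  by (simp add: sentence_def)

lemma tfv_tsubst: "tfv r = {} \<Longrightarrow> tfv (tsubst x r t) = tfv t - {x}"
  by (induction t) auto

lemma fv_subst: "tfv r = {} \<Longrightarrow> fv (subst x r A) = fv A - {x}"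
  by (induction A) (auto simp: tfv_tsubst)

lemma set_fml_subst [simp]: "set_fml (subst x r A) = set_fml A"
  by (induction A) auto

lemma rk_subst [simp]: "rk (subst x r A) = rk A"
  by (induction A) auto

lemma fv_map_fml [simp]: "fv (map_fml g A) = fv A"
  by (induction A) auto

lemma tfv_anum [simp]: "tfv (anum n) = {}"
  unfolding anum_def by (induction n) auto

lemma tval_closed: "tfv t = {} \<Longrightarrow> tval e t = tval e' t"
  by (induction t) auto

lemma onum_eq_iff [simp]: "onum m = onum n \<longleftrightarrow> m = n"
  by (metis onum_prec_iff linorder_cases less_irrefl)

lemma onum_0: "onum 0 = Sq []"
  by (simp add: onum_def)

section \<open>Ranks of sentences\<close>

lemma rk_OT: "\<forall>p\<in>set_fml A. snd p \<in> OT \<Longrightarrow> rk A \<in> OT"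
  by (induction A) (auto simp: onum_0 omega_times_OT oadd_one_OT omax_def)

lemma sentence_rk_OT: "sentence A \<Longrightarrow> rk A \<in> OT"
  by (rule rk_OT) (auto simp: sentence_def)

text \<open>The rank involves no \<vartheta>-terms beyond those in the parameters of the formula. An
  exponent read off a cut rank is therefore controlled whenever the cut formula is.\<close>

lemma Eset_rk: "\<forall>p\<in>set_fml A. snd p \<in> OT \<Longrightarrow> Eset (rk A) \<subseteq> \<Union> (Eset ` snd ` set_fml A)"
proof (induction A)
  case (Or A B)
  then have "omax (rk A) (rk B) \<in> OT" by (auto simp: omax_def rk_OT)
  then show ?case using Or by (auto simp: omax_def split: if_splits)
next
  case (And A B)
  then have "omax (rk A) (rk B) \<in> OT" by (auto simp: omax_def rk_OT)
  then show ?case using And by (auto simp: omax_def split: if_splits)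
qed (auto simp: onum_0 rk_OT)

lemma omax_ge: "a \<preceq> omax a b" "b \<preceq> omax a b"
  using prec_linear[of a b] by (auto simp: omax_def)

text \<open>Literals have rank 0 or \<omega>\<cdot>\<open>c\<close>, and the connectives and
  quantifiers add finitely many successors, which stay below the limit
  \<omega>\<cdot>\<open>a\<close>.\<close>

lemma rk_map_fml_prec:
  assumes "a \<in> OT" "c \<in> OT" "c \<prec> a"
  shows "rk (map_fml (\<lambda>_. (\<phi>, c)) B) \<prec> omega_times a"
proof -
  have 0: "onum 0 \<prec> omega_times a"
    unfolding onum_0 by (rule zero_prec_omega_times) (use assms in auto)
  have OT: "rk (map_fml (\<lambda>_. (\<phi>, c)) B) \<in> OT" for B :: "'b fml"
    by (rule rk_OT) (use assms in \<open>auto simp: fml.set_map\<close>)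
  have succ: "x \<oplus> onum 1 \<prec> omega_times a" if "x \<in> OT" "x \<prec> omega_times a" for x
    using prec_omega_times_succ that assms by blast
  have succ2: "omax x y \<oplus> onum 1 \<prec> omega_times a"
    if "x \<in> OT" "x \<prec> omega_times a" "y \<in> OT" "y \<prec> omega_times a" for x y
    using that by (intro succ) (auto simp: omax_def)
  show ?thesis
    by (induction B)
      (use 0 omega_times_mono[OF assms(2,1,3)] succ[OF OT] succ2[OF OT _ OT] in simp_all)
qed

section \<open>Components of disjunctions\<close>

lemma disj_of_rk:
  assumes "disj_of A d f" "sentence A" "c \<in> seg d"
  shows "rk (f c) \<prec> rk A"
  using assms
proof cases
  case (3 \<phi> t)
  then show ?thesis using assms rk_map_fml_prec[of d c \<phi>]
    by (auto simp: op_inst_def seg_def sentence_def)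
next
  case (4 A' B')
  then have "rk A' \<in> OT" "rk B' \<in> OT"
    using assms(2) by (auto intro!: rk_OT simp: sentence_def)
  then have "omax (rk A') (rk B') \<in> OT" by (auto simp: omax_def)
  then have "omax (rk A') (rk B') \<prec> rk A" using prec_oadd_one 4 by simp
  then show ?thesis using seg_onum_2[of c] 4 assms(3) omax_ge preceq_prec_trans by metis
next
  case (5 x A')
  obtain n where "c = onum n" using seg_oomega assms(3) 5 by blast
  moreover have "rk A' \<in> OT" using assms(2) 5 by (auto intro!: rk_OT simp: sentence_def)
  ultimately show ?thesis using 5 prec_oadd_one by simp
qed (auto simp: seg_def onum_0)

lemma disj_of_set_fml:
  assumes "disj_of A d f" "c \<in> seg d"
  shows "snd ` set_fml (f c) \<subseteq> insert c (snd ` set_fml A)"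
  using assms
proof cases
  case (4 A' B')
  then show ?thesis using seg_onum_2[of c] assms(2) by auto
next
  case (5 x A')
  then show ?thesis using seg_oomega assms(2) by (metis set_fml_subst fml.set(7) subset_insertI)
qed (use assms(2) in \<open>auto simp: seg_def onum_0 op_inst_def fml.set_map\<close>)

lemma disj_of_sentence:
  assumes "disj_of A d f" "sentence A" "c \<in> seg d"
  shows "sentence (f c)"
  using assms
proof cases
  case (3 \<phi> t)
  then have "operator_form \<phi>" "tfv t = {}" "d \<preceq> Om" using assms(2) by (auto simp: sentence_def)
  moreover from this obtain x where "fv \<phi> = {x}" by (auto simp: operator_form_def)
  moreover have "c \<in> OT" "c \<preceq> Om"
    using assms(3) prec_preceq_trans[of c d Om] calculation by (auto simp: seg_def)
  ultimately show ?thesis using 3 assms(3)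
    by (auto simp: sentence_def op_inst_def fml.set_map fv_subst)
next
  case (4 A' B')
  then show ?thesis using seg_onum_2[of c] assms by (auto simp: sentence_def)
next
  case (5 x A')
  obtain n where "c = onum n" using seg_oomega assms(3) 5 by blast
  then show ?thesis using 5 assms(2) by (auto simp: sentence_def fv_subst)
qed (use assms in \<open>auto simp: seg_def onum_0\<close>)

inductive_cases disj_of_EqE: "disj_of (Eq s t) d f"
inductive_cases disj_of_NeqE: "disj_of (Neq s t) d f"
inductive_cases disj_of_PredE: "disj_of (Pred p t) d f"
inductive_cases disj_of_NPredE: "disj_of (NPred p t) d f"
inductive_cases disj_of_OrE: "disj_of (Or A B) d f"
inductive_cases disj_of_AndE: "disj_of (And A B) d f"
inductive_cases disj_of_ExE: "disj_of (Ex x A) d f"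
inductive_cases disj_of_AllE: "disj_of (All x A) d f"

lemmas disj_of_cases =
  disj_of_EqE disj_of_NeqE disj_of_PredE disj_of_NPredE disj_of_OrE disj_of_AndE disj_of_ExE disj_of_AllE

lemma disj_of_unique:
  assumes "disj_of A d f" "disj_of A d' g"
  shows "d = d' \<and> (\<forall>c\<in>seg d. f c = g c)"
  using assms(1)
proof cases
  case 4
  then show ?thesis using assms(2) by (auto elim!: disj_of_OrE dest!: seg_onum_2)
next
  case (5 x A')
  have "f c = g c" if "c \<in> seg oomega" for c
  proof -
    obtain n where "c = onum n" using seg_oomega[OF \<open>c \<in> seg oomega\<close>] by blast
    then show ?thesis using 5 assms(2) by (auto elim!: disj_of_ExE)
  qed
  then show ?thesis using 5 assms(2) by (auto elim!: disj_of_ExE)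
qed (use assms(2) in \<open>auto elim!: disj_of_cases simp: seg_def onum_0\<close>)

text \<open>With \<open>disj_of_exists\<close>, every sentence is either disjunctive or conjunctive,
  but not both. This decides which of (Conj) and (Disj) can act on a given cut formula.\<close>

lemma disj_of_neg_exclusive: "disj_of A d f \<Longrightarrow> \<not> disj_of (neg A) d' g"
  by (induction rule: disj_of.induct) (auto elim!: disj_of_cases)

lemma disj_of_exists:
  assumes "sentence A"
  shows "\<exists>d f. disj_of A d f \<or> disj_of (neg A) d f"
proof -
  have Or: "\<exists>d f. disj_of (Or B C) d f" for B C
    using disj_of.intros(4)[of "\<lambda>c. if c = onum 0 then B else C", OF refl refl] by auto
  have Ex: "\<exists>d f. disj_of (Ex x B) d f" for x B
  proof -
    \<comment> \<open>The component function is defined on all terms, so the index of the instance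
      is recovered by inverting the injective \<open>onum\<close>.\<close>
    have "(THE n. onum m = onum n) = m" for m by (rule the_equality) auto
    then show ?thesis
      using disj_of.intros(5)[of "\<lambda>c. subst x (anum (THE n. c = onum n)) B" x B] by auto
  qed
  have Pred: "\<exists>d f. disj_of (Pred p t) d f" for p t
    using disj_of.intros(3)[of "snd p" "op_inst (fst p) t" "fst p" t] by (cases p) auto
  \<comment> \<open>Closed terms have the same value in every environment, so a single evaluation
    decides the equation.\<close>
  have EqNeq: "\<exists>d f. disj_of (Eq s t) d f \<or> disj_of (Neq s t) d f" if st: "tfv s = {}" "tfv t = {}" for s t
  proof (cases "tval (\<lambda>_. 0) s = tval (\<lambda>_. 0) t")
    case True
    then have "tval e s = tval e t" for e
      using tval_closed[OF st(1), of e "\<lambda>_. 0"] tval_closed[OF st(2), of e "\<lambda>_. 0"] by simp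
    then show ?thesis using disj_of.intros(2) by blast
  next
    case False
    then have "tval e s \<noteq> tval e t" for e
      using tval_closed[OF st(1), of e "\<lambda>_. 0"] tval_closed[OF st(2), of e "\<lambda>_. 0"] by simp
    then show ?thesis using disj_of.intros(1) by blast
  qed
  show ?thesis
  proof (cases A)
    case (Eq s t)
    then show ?thesis using assms EqNeq[of s t] by (auto simp: sentence_def)
  next
    case (Neq s t)
    then show ?thesis using assms EqNeq[of s t] by (auto simp: sentence_def)
  qed (simp_all add: ex_disj_distrib Or Ex Pred)
qed

lemma conj_ofE:
  assumes "conj_of A d f"
  obtains B g where "A = neg B" "f = (\<lambda>c. neg (g c))" "disj_of B d g"
  using assms by cases blast

lemma kset_insert [simp]: "kset (insert A \<Gamma>) = snd ` set_fml A \<union> kset \<Gamma>"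
  by (simp add: kset_def)

subsection \<open>Derivations\<close>

lemma deriv_control:
  assumes "deriv \<rho> H \<alpha> \<Gamma>"
  shows "\<alpha> \<in> H {}" "kset \<Gamma> \<subseteq> H {}"
  using assms by (cases; auto)+

text \<open>In this form the parameter that (Conj) adds to the operator becomes an
  \<open>insert\<close> into \<open>X\<close>.\<close>

lemmas Hop_Conj = deriv.Conj[where H = "adjoin (Hop h) X" for h X, simplified]
lemmas Hop_Disj = deriv.Disj[where H = "adjoin (Hop h) X" for h X, simplified]
lemmas Hop_Cut = deriv.Cut[where H = "adjoin (Hop h) X" for h X, simplified]
lemmas Hop_Fix = deriv.Fix[where H = "adjoin (Hop h) X" for h X, simplified]
lemmas Hop_control = deriv_control[where H = "adjoin (Hop h) X" for h X, simplified]

text \<open>The operator keeps the form \<open>adjoin (Hop h) X\<close> throughout a derivation, so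
  only the set \<open>X\<close> has to vary. The premise heights of (Conj) are supplied as a
  function of the index.\<close>

lemma deriv_Hop_induct [consumes 1, case_names Conj Disj Cut Fix]:
  assumes "deriv \<rho> (adjoin (Hop h) X) \<alpha> \<Gamma>"
    and Conj: "\<And>X \<alpha> \<Gamma> A d f \<alpha>'. \<alpha> \<in> Hop h X \<Longrightarrow> kset \<Gamma> \<subseteq> Hop h X \<Longrightarrow> A \<in> \<Gamma> \<Longrightarrow> conj_of A d f \<Longrightarrow>
      (\<And>c. c \<in> seg d \<Longrightarrow> \<alpha>' c \<in> seg \<alpha>) \<Longrightarrow>
      (\<And>c. c \<in> seg d \<Longrightarrow> deriv \<rho> (adjoin (Hop h) (insert c X)) (\<alpha>' c) (insert (f c) \<Gamma>)) \<Longrightarrow>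
      (\<And>c. c \<in> seg d \<Longrightarrow> P (insert c X) (\<alpha>' c) (insert (f c) \<Gamma>)) \<Longrightarrow> P X \<alpha> \<Gamma>"
    and Disj: "\<And>X \<alpha> \<Gamma> A d f c \<alpha>'. \<alpha> \<in> Hop h X \<Longrightarrow> kset \<Gamma> \<subseteq> Hop h X \<Longrightarrow> A \<in> \<Gamma> \<Longrightarrow> disj_of A d f \<Longrightarrow>
      c \<in> seg d \<Longrightarrow> c \<prec> \<alpha> \<Longrightarrow> c \<in> Hop h X \<Longrightarrow> \<alpha>' \<in> seg \<alpha> \<Longrightarrow>
      deriv \<rho> (adjoin (Hop h) X) \<alpha>' (insert (f c) \<Gamma>) \<Longrightarrow> P X \<alpha>' (insert (f c) \<Gamma>) \<Longrightarrow> P X \<alpha> \<Gamma>"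
    and Cut: "\<And>X \<alpha> \<Gamma> A \<alpha>'. \<alpha> \<in> Hop h X \<Longrightarrow> kset \<Gamma> \<subseteq> Hop h X \<Longrightarrow> sentence A \<Longrightarrow> rk A \<prec> \<rho> \<Longrightarrow>
      \<alpha>' \<in> seg \<alpha> \<Longrightarrow> deriv \<rho> (adjoin (Hop h) X) \<alpha>' (insert A \<Gamma>) \<Longrightarrow> P X \<alpha>' (insert A \<Gamma>) \<Longrightarrow>
      deriv \<rho> (adjoin (Hop h) X) \<alpha>' (insert (neg A) \<Gamma>) \<Longrightarrow> P X \<alpha>' (insert (neg A) \<Gamma>) \<Longrightarrow> P X \<alpha> \<Gamma>"
    and Fix: "\<And>X \<alpha> \<Gamma> \<phi> t \<alpha>'. \<alpha> \<in> Hop h X \<Longrightarrow> kset \<Gamma> \<subseteq> Hop h X \<Longrightarrow> Om \<preceq> \<alpha> \<Longrightarrow> Pred (\<phi>, Om) t \<in> \<Gamma> \<Longrightarrow>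
      \<alpha>' \<in> seg \<alpha> \<Longrightarrow> deriv \<rho> (adjoin (Hop h) X) \<alpha>' (insert (op_inst \<phi> t Om) \<Gamma>) \<Longrightarrow>
      P X \<alpha>' (insert (op_inst \<phi> t Om) \<Gamma>) \<Longrightarrow> P X \<alpha> \<Gamma>"
  shows "P X \<alpha> \<Gamma>"
  using assms(1)
proof (induction "adjoin (Hop h) X" \<alpha> \<Gamma> arbitrary: X rule: deriv.induct)
  case (Conj \<alpha> \<Gamma> A d f)
  have "\<forall>c\<in>seg d. \<exists>\<beta>. \<beta> \<in> seg \<alpha> \<and> deriv \<rho> (adjoin (Hop h) (insert c X)) \<beta> (insert (f c) \<Gamma>) \<and>
    P (insert c X) \<beta> (insert (f c) \<Gamma>)"
  proof
    fix c assume "c \<in> seg d"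
    from Conj(4)[OF this] show "\<exists>\<beta>. \<beta> \<in> seg \<alpha> \<and> deriv \<rho> (adjoin (Hop h) (insert c X)) \<beta> (insert (f c) \<Gamma>) \<and>
      P (insert c X) \<beta> (insert (f c) \<Gamma>)" by auto
  qed
  then obtain \<alpha>' where "\<forall>c\<in>seg d. \<alpha>' c \<in> seg \<alpha> \<and>
    deriv \<rho> (adjoin (Hop h) (insert c X)) (\<alpha>' c) (insert (f c) \<Gamma>) \<and>
    P (insert c X) (\<alpha>' c) (insert (f c) \<Gamma>)"
    unfolding bchoice_iff by blast
  then show ?case by (intro assms(2)[OF _ _ Conj(2,3)]) (use Conj(1) in auto)
next
  case (Disj \<alpha> \<Gamma> A d f c \<alpha>')
  show ?case
    by (rule assms(3)[OF _ _ Disj(2,3,4,5) _ Disj(7)]) (use Disj in auto)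
next
  case (Cut \<alpha> \<Gamma> A \<alpha>')
  show ?case
    by (rule assms(4)[OF _ _ Cut(2,3,4)]) (use Cut in auto)
next
  case (Fix \<alpha> \<Gamma> \<phi> t \<alpha>')
  show ?case
    by (rule assms(5)[OF _ _ Fix(2,3,4)]) (use Fix in auto)
qed

lemma seg_mono: "a \<preceq> b \<Longrightarrow> seg a \<subseteq> seg b"
  using prec_preceq_trans[of _ a b] by (auto simp: seg_def)

lemma deriv_mono:
  assumes "deriv \<rho> (adjoin (Hop h) X) \<alpha> \<Gamma>" "\<rho> \<preceq> \<rho>'" "X \<subseteq> X'" "\<Gamma> \<subseteq> \<Gamma>'" "\<alpha> \<preceq> \<alpha>'"
    "\<alpha>' \<in> Hop h X'" "kset \<Gamma>' \<subseteq> Hop h X'"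
  shows "deriv \<rho>' (adjoin (Hop h) X') \<alpha>' \<Gamma>'"
  using assms(1,3-)
proof (induction arbitrary: X' \<alpha>' \<Gamma>' rule: deriv_Hop_induct)
  case (Conj X \<alpha> \<Gamma> A d f \<beta>)
  show ?case
  proof (rule Hop_Conj[OF _ _ Conj(4)])
    fix c assume c: "c \<in> seg d"
    have sub: "Hop h (insert c X) \<subseteq> Hop h (insert c X')" "Hop h X' \<subseteq> Hop h (insert c X')"
      using Conj.prems by (auto intro!: Hop_mono)
    have "deriv \<rho>' (adjoin (Hop h) (insert c X')) (\<beta> c) (insert (f c) \<Gamma>')"
      by (rule Conj.IH[OF c]) (use Conj.prems sub Hop_control[OF Conj(6)[OF c]] in auto)
    then show "\<exists>\<beta>\<in>seg \<alpha>'. deriv \<rho>' (adjoin (Hop h) (insert c X')) \<beta> (insert (f c) \<Gamma>')"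
      using Conj(5)[OF c] seg_mono[of \<alpha> \<alpha>'] Conj.prems by blast
  qed (use Conj in auto)
next
  case (Disj X \<alpha> \<Gamma> A d f c \<beta>)
  have sub: "Hop h X \<subseteq> Hop h X'" using Disj.prems by (auto intro!: Hop_mono)
  have "deriv \<rho>' (adjoin (Hop h) X') \<beta> (insert (f c) \<Gamma>')"
    by (rule Disj.IH) (use Disj.prems sub Hop_control[OF Disj(9)] in auto)
  then show ?case
  proof (rule Hop_Disj[OF _ _ Disj(4,5), rotated -1])
    show "\<alpha>' \<in> Hop h X' \<and> kset \<Gamma>' \<subseteq> Hop h X'" "A \<in> \<Gamma>'" "c \<in> Hop h X'"
      using Disj.prems Disj(3,7) sub by auto
    show "c \<prec> \<alpha>'" using Disj(6) Disj.prems(3) by (rule prec_preceq_trans)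
    show "\<beta> \<in> seg \<alpha>'" using Disj(8) seg_mono[OF Disj.prems(3)] by blast
  qed
next
  case (Cut X \<alpha> \<Gamma> A \<beta>)
  have sub: "Hop h X \<subseteq> Hop h X'" using Cut.prems by (auto intro!: Hop_mono)
  have "deriv \<rho>' (adjoin (Hop h) X') \<beta> (insert A \<Gamma>')"
    by (rule Cut.IH(1)) (use Cut.prems sub Hop_control[OF Cut(6)] in auto)
  moreover have "deriv \<rho>' (adjoin (Hop h) X') \<beta> (insert (neg A) \<Gamma>')"
    by (rule Cut.IH(2)) (use Cut.prems sub Hop_control[OF Cut(6)] in auto)
  ultimately show ?case
  proof (rule Hop_Cut[OF _ Cut(3), rotated -2])
    show "\<alpha>' \<in> Hop h X' \<and> kset \<Gamma>' \<subseteq> Hop h X'" using Cut.prems by blast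
    show "rk A \<prec> \<rho>'" using Cut(4) assms(2) by (rule prec_preceq_trans)
    show "\<beta> \<in> seg \<alpha>'" using Cut(5) seg_mono[OF Cut.prems(3)] by blast
  qed
next
  case (Fix X \<alpha> \<Gamma> \<phi> t \<beta>)
  have sub: "Hop h X \<subseteq> Hop h X'" using Fix.prems by (auto intro!: Hop_mono)
  have "deriv \<rho>' (adjoin (Hop h) X') \<beta> (insert (op_inst \<phi> t Om) \<Gamma>')"
    by (rule Fix.IH) (use Fix.prems sub Hop_control[OF Fix(6)] in auto)
  then show ?case
  proof (rule Hop_Fix[rotated -1])
    show "\<alpha>' \<in> Hop h X' \<and> kset \<Gamma>' \<subseteq> Hop h X'" "Pred (\<phi>, Om) t \<in> \<Gamma>'"
      using Fix.prems Fix(4) by auto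
    show "Om \<preceq> \<alpha>'" using Fix(3) Fix.prems(3) by (rule preceq_trans)
    show "\<beta> \<in> seg \<alpha>'" using Fix(5) seg_mono[OF Fix.prems(3)] by blast
  qed
qed

section \<open>Inversion and reduction of a single cut\<close>

lemma not_Om_le: "a \<prec> Om \<Longrightarrow> \<not> Om \<preceq> a"
  using prec_asym[of a Om] by auto

lemma seg_prec_trans: "a \<in> seg b \<Longrightarrow> b \<preceq> c \<Longrightarrow> a \<prec> c"
  using prec_preceq_trans[of a b c] by (simp add: seg_def)

lemma kset_disj_of:
  assumes "disj_of C d f" "c \<in> seg d" "kset (insert C \<Gamma>) \<subseteq> Hop h X"
  shows "kset (insert (neg (f c)) \<Gamma>) \<subseteq> Hop h (insert c X)"
proof -
  have "c \<in> Hop h (insert c X)" using seg_OT[OF assms(2)] by (auto intro: Hop_member)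
  moreover have "Hop h X \<subseteq> Hop h (insert c X)" by (auto intro!: Hop_mono)
  ultimately show ?thesis
    using disj_of_set_fml[OF assms(1,2)] assms(3) unfolding kset_insert set_fml_neg by blast
qed

text \<open>Derivations of height below \<open>\<Omega>\<close> do not use the rule (Fix).\<close>

lemma inversion:
  assumes "deriv \<rho> (adjoin (Hop h) X) \<alpha> \<Delta>" "\<alpha> \<prec> Om" "\<Delta> \<subseteq> insert (neg C) \<Gamma>"
    "kset (insert C \<Gamma>) \<subseteq> Hop h X" and C: "disj_of C d f" and c: "c \<in> seg d"
  shows "deriv \<rho> (adjoin (Hop h) (insert c X)) \<alpha> (insert (neg (f c)) \<Gamma>)"
  using assms(1-4)
proof (induction arbitrary: \<Gamma> rule: deriv_Hop_induct)
  case (Conj X \<alpha> \<Delta> A d' g \<beta>)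
  have sub: "Hop h X \<subseteq> Hop h (insert b X)" for b by (auto intro!: Hop_mono)
  note k = kset_disj_of[OF C c Conj.prems(3)]
  show ?case
  proof (cases "A = neg C")
    case True
    then obtain g' where g': "g = (\<lambda>c. neg (g' c))" "disj_of C d' g'"
      using Conj(4) by (metis conj_ofE neg_neg)
    then have d: "d' = d" "g' c = f c" using disj_of_unique[OF C g'(2)] c by auto
    have \<beta>: "\<beta> c \<in> seg \<alpha>" using Conj(5) c d by blast
    \<comment> \<open>The premise for index \<open>c\<close> already contains
      \<open>neg (f c)\<close> but may still contain \<open>neg C\<close>, which the induction
      hypothesis removes. The parameter and the formula that it adds are duplicates and vanish in
      the sets.\<close>
    have "deriv \<rho> (adjoin (Hop h) (insert c (insert c X))) (\<beta> c) (insert (neg (f c)) (insert (neg (f c)) \<Gamma>))"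
    proof (rule Conj.IH)
      show "c \<in> seg d'" using c d by simp
      show "\<beta> c \<prec> Om" using \<beta> Conj.prems seg_prec_trans by blast
      show "insert (g c) \<Delta> \<subseteq> insert (neg C) (insert (neg (f c)) \<Gamma>)" using Conj.prems d g' by auto
      show "kset (insert C (insert (neg (f c)) \<Gamma>)) \<subseteq> Hop h (insert c X)"
        using k Conj.prems sub[of c] by auto
    qed
    then have "deriv \<rho> (adjoin (Hop h) (insert c X)) (\<beta> c) (insert (neg (f c)) \<Gamma>)" by simp
    then show ?thesis
      by (rule deriv_mono) (use \<beta> k Conj(1) sub[of c] in \<open>auto simp: seg_def\<close>)
  next
    case False
    then have A: "A \<in> insert (neg (f c)) \<Gamma>" using Conj by auto
    show ?thesis
    proof (rule Hop_Conj[OF _ A Conj(4)])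
      show "\<alpha> \<in> Hop h (insert c X) \<and> kset (insert (neg (f c)) \<Gamma>) \<subseteq> Hop h (insert c X)"
        using k Conj(1) sub[of c] by auto
    next
      fix b assume b: "b \<in> seg d'"
      have "deriv \<rho> (adjoin (Hop h) (insert c (insert b X))) (\<beta> b) (insert (neg (f c)) (insert (g b) \<Gamma>))"
      proof (rule Conj.IH[OF b])
        show "\<beta> b \<prec> Om" using Conj(5)[OF b] Conj.prems seg_prec_trans by blast
        show "insert (g b) \<Delta> \<subseteq> insert (neg C) (insert (g b) \<Gamma>)" using Conj.prems by auto
        show "kset (insert C (insert (g b) \<Gamma>)) \<subseteq> Hop h (insert b X)"
          using Hop_control(2)[OF Conj(6)[OF b]] Conj.prems sub[of b] by auto
      qed
      then show "\<exists>\<beta>\<in>seg \<alpha>. deriv \<rho> (adjoin (Hop h) (insert b (insert c X))) \<beta> (insert (g b) (insert (neg (f c)) \<Gamma>))"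
        using Conj(5)[OF b] by (auto simp: insert_commute)
    qed
  qed
next
  case (Disj X \<alpha> \<Delta> A d' g b \<beta>)
  have sub: "Hop h X \<subseteq> Hop h (insert c X)" by (auto intro!: Hop_mono)
  note k = kset_disj_of[OF C c Disj.prems(3)]
  have "A \<noteq> neg C" using disj_of_neg_exclusive[OF C] Disj(4) by blast
  then have A: "A \<in> insert (neg (f c)) \<Gamma>" using Disj by auto
  have "deriv \<rho> (adjoin (Hop h) (insert c X)) \<beta> (insert (neg (f c)) (insert (g b) \<Gamma>))"
  proof (rule Disj.IH)
    show "\<beta> \<prec> Om" using Disj(8) Disj.prems seg_prec_trans by blast
    show "insert (g b) \<Delta> \<subseteq> insert (neg C) (insert (g b) \<Gamma>)" using Disj.prems by auto
    show "kset (insert C (insert (g b) \<Gamma>)) \<subseteq> Hop h X"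
      using Hop_control(2)[OF Disj(9)] Disj.prems by auto
  qed
  then show ?case
    by (intro Hop_Disj[OF _ A Disj(4,5,6) _ Disj(8)])
      (use k Disj(1,7) sub in \<open>auto simp: insert_commute\<close>)
next
  case (Cut X \<alpha> \<Delta> A \<beta>)
  have sub: "Hop h X \<subseteq> Hop h (insert c X)" by (auto intro!: Hop_mono)
  note k = kset_disj_of[OF C c Cut.prems(3)]
  have "\<beta> \<prec> Om" using Cut(5) Cut.prems seg_prec_trans by blast
  have "deriv \<rho> (adjoin (Hop h) (insert c X)) \<beta> (insert (neg (f c)) (insert A \<Gamma>))"
    by (rule Cut.IH(1)) (use Cut.prems Hop_control(2)[OF Cut(6)] \<open>\<beta> \<prec> Om\<close> in auto)
  moreover have "deriv \<rho> (adjoin (Hop h) (insert c X)) \<beta> (insert (neg (f c)) (insert (neg A) \<Gamma>))"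
    by (rule Cut.IH(2)) (use Cut.prems Hop_control(2)[OF Cut(6)] \<open>\<beta> \<prec> Om\<close> in auto)
  ultimately show ?case
    by (intro Hop_Cut[OF _ Cut(3,4,5)]) (use k Cut(1) sub in \<open>auto simp: insert_commute\<close>)
next
  case (Fix X \<alpha> \<Delta> \<phi> t \<beta>)
  then show ?case using not_Om_le by blast
qed

lemma Th_Th_append_OT:
  assumes "Th x \<in> OT" "b \<in> OT" "b \<preceq> Th x"
  shows "Sq (Th x # Th x # entries b) \<in> OT"
proof -
  have "y \<preceq> Th x" if "y \<in> set (entries b)" for y
  proof (cases "principal b")
    case True
    then show ?thesis using that assms entries_principal by auto
  next
    case False
    then obtain bs where "b = Sq bs" by (cases b) auto
    then show ?thesis using that assms Sq_prec_principal_iff[of bs "Th x"] by auto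
  qed
  then show ?thesis using assms desc_entries entries_OT[OF assms(2)] by (auto simp: Sq_in_OT_iff)
qed

lemma Th_Th_append_Hop:
  assumes "Th x \<in> Hop h X" "b \<in> Hop h X" "b \<preceq> Th x"
  shows "Sq (Th x # Th x # entries b) \<in> Hop h X"
proof (rule Hop_of_Eset[OF Th_Th_append_OT])
  show "Eset (Sq (Th x # Th x # entries b)) \<subseteq> Hop h X"
    using assms(1) Hop_Eset[OF assms(2)] Eset_entries[of b] by auto
qed (use Hop_OT[OF assms(1)] Hop_OT[OF assms(2)] assms(3) in auto)

text \<open>
  The height \<open>\<epsilon>\<cdot>2 + \<beta>\<close> for \<open>\<epsilon> = Th x \<succeq> \<beta>\<close>. The second copy of \<open>\<epsilon>\<close> keeps the sequence a term when \<open>\<beta> = 0\<close>.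
\<close>

lemma reduction:
  assumes "deriv \<rho> (adjoin (Hop h) X) \<beta> \<Delta>" "\<beta> \<preceq> Th x" "\<Delta> \<subseteq> insert C \<Gamma>"
    "deriv \<rho> (adjoin (Hop h) X) (Th x) (insert (neg C) \<Gamma>)"
    and C: "disj_of C d f" "sentence C" "rk C = \<rho>"
  shows "deriv \<rho> (adjoin (Hop h) X) (Sq (Th x # Th x # entries \<beta>)) \<Gamma>"
  using assms(1-4)
proof (induction arbitrary: \<Gamma> rule: deriv_Hop_induct)
  case (Conj X \<beta> \<Delta> A d' g \<gamma>)
  note eps = Hop_control[OF Conj.prems(3)]
  have H: "Sq (Th x # Th x # entries \<beta>) \<in> Hop h X"
    by (rule Th_Th_append_Hop[OF eps(1) Conj(1) Conj.prems(1)])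
  have sub: "Hop h X \<subseteq> Hop h (insert b X)" for b by (auto intro!: Hop_mono)
  have "A \<noteq> C" using disj_of_neg_exclusive[OF C(1)] Conj(4) by (metis conj_ofE neg_neg)
  then have A: "A \<in> \<Gamma>" using Conj by auto
  show ?case
  proof (rule Hop_Conj[OF _ A Conj(4)])
    show "Sq (Th x # Th x # entries \<beta>) \<in> Hop h X \<and> kset \<Gamma> \<subseteq> Hop h X" using H eps by auto
    fix b assume b: "b \<in> seg d'"
    have "deriv \<rho> (adjoin (Hop h) (insert b X)) (Sq (Th x # Th x # entries (\<gamma> b))) (insert (g b) \<Gamma>)"
    proof (rule Conj.IH[OF b])
      show "\<gamma> b \<preceq> Th x" using Conj(5)[OF b] Conj.prems seg_prec_trans by blast
      show "insert (g b) \<Delta> \<subseteq> insert C (insert (g b) \<Gamma>)" using Conj.prems by auto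
      show "deriv \<rho> (adjoin (Hop h) (insert b X)) (Th x) (insert (neg C) (insert (g b) \<Gamma>))"
        by (rule deriv_mono[OF Conj.prems(3)])
          (use eps sub[of b] Hop_control(2)[OF Conj(6)[OF b]] in auto)
    qed
    moreover have "Sq (Th x # Th x # entries (\<gamma> b)) \<prec> Sq (Th x # Th x # entries \<beta>)"
      using Conj(5)[OF b] prec_iff_entries[of "\<gamma> b" \<beta>] Hop_OT[OF Conj(1)] by (simp add: seg_def)
    ultimately show "\<exists>\<gamma>\<in>seg (Sq (Th x # Th x # entries \<beta>)). deriv \<rho> (adjoin (Hop h) (insert b X)) \<gamma> (insert (g b) \<Gamma>)"
      using Hop_OT[OF Hop_control(1)] unfolding seg_def by blast
  qed
next
  case (Disj X \<beta> \<Delta> A d' g c \<gamma>)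
  note eps = Hop_control[OF Disj.prems(3)]
  have H: "Sq (Th x # Th x # entries \<beta>) \<in> Hop h X"
    by (rule Th_Th_append_Hop[OF eps(1) Disj(1) Disj.prems(1)])
  have IH: "deriv \<rho> (adjoin (Hop h) X) (Sq (Th x # Th x # entries \<gamma>)) (insert (g c) \<Gamma>)"
  proof (rule Disj.IH)
    show "\<gamma> \<preceq> Th x" using Disj(8) Disj.prems seg_prec_trans by blast
    show "insert (g c) \<Delta> \<subseteq> insert C (insert (g c) \<Gamma>)" using Disj.prems by auto
    show "deriv \<rho> (adjoin (Hop h) X) (Th x) (insert (neg C) (insert (g c) \<Gamma>))"
      by (rule deriv_mono[OF Disj.prems(3)])
        (use eps Hop_control(2)[OF Disj(9)] in auto)
  qed
  note IHc = Hop_control[OF IH]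
  have "Sq (Th x # Th x # entries \<gamma>) \<prec> Sq (Th x # Th x # entries \<beta>)"
    using Disj(8) prec_iff_entries[of \<gamma> \<beta>] Hop_OT[OF Disj(1)] by (simp add: seg_def)
  then have seg: "Sq (Th x # Th x # entries \<gamma>) \<in> seg (Sq (Th x # Th x # entries \<beta>))"
    using Hop_OT[OF IHc(1)] by (simp add: seg_def)
  show ?case
  proof (cases "A = C")
    case True
    \<comment> \<open>The critical case: the cut formula itself is introduced, with witness
      \<open>c\<close>. Inversion at \<open>c\<close> adds only a parameter that is already
      controlled, and the new cut on \<open>f c\<close> has rank below \<rho>.\<close>
    then have d: "d' = d" "g c = f c" using disj_of_unique[OF _ C(1)] Disj(4,5) by blast+
    have "deriv \<rho> (adjoin (Hop h) (insert c X)) (Th x) (insert (neg (f c)) \<Gamma>)"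
      by (rule inversion[OF Disj.prems(3) _ subset_refl _ C(1)]) (use eps Disj(5) d in auto)
    then have "deriv \<rho> (adjoin (Hop h) X) (Th x) (insert (neg (f c)) \<Gamma>)"
      using adjoin_Hop_insert[OF Disj(7)] by simp
    then have "deriv \<rho> (adjoin (Hop h) X) (Sq (Th x # Th x # entries \<gamma>)) (insert (neg (f c)) \<Gamma>)"
      by (rule deriv_mono) (use IHc d in auto)
    then show ?thesis
    proof (rule Hop_Cut[OF _ _ _ seg, rotated -1])
      show "sentence (f c)" "rk (f c) \<prec> \<rho>"
        using C d(1) Disj(5) disj_of_sentence disj_of_rk by blast+
    qed (use IH d H eps in auto)
  next
    case False
    then have A: "A \<in> \<Gamma>" using Disj by auto
    have "c \<prec> Th x" using Disj(6) Disj.prems prec_preceq_trans by blast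
    moreover have "Th x \<prec> Sq (Th x # Th x # entries \<beta>)" by simp
    ultimately have "c \<prec> Sq (Th x # Th x # entries \<beta>)" by (rule prec_trans)
    then show ?thesis
      by (rule Hop_Disj[OF _ A Disj(4,5) _ Disj(7) seg IH, rotated]) (use H eps in auto)
  qed
next
  case (Cut X \<beta> \<Delta> A \<gamma>)
  note eps = Hop_control[OF Cut.prems(3)]
  have H: "Sq (Th x # Th x # entries \<beta>) \<in> Hop h X"
    by (rule Th_Th_append_Hop[OF eps(1) Cut(1) Cut.prems(1)])
  have \<gamma>: "\<gamma> \<preceq> Th x" using Cut(5) Cut.prems seg_prec_trans by blast
  have IH: "deriv \<rho> (adjoin (Hop h) X) (Sq (Th x # Th x # entries \<gamma>)) (insert A \<Gamma>)"
    by (rule Cut.IH(1)[OF \<gamma> _ deriv_mono[OF Cut.prems(3)]])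
      (use Cut.prems eps Hop_control(2)[OF Cut(6)] in auto)
  have IH2: "deriv \<rho> (adjoin (Hop h) X) (Sq (Th x # Th x # entries \<gamma>)) (insert (neg A) \<Gamma>)"
    by (rule Cut.IH(2)[OF \<gamma> _ deriv_mono[OF Cut.prems(3)]])
      (use Cut.prems eps Hop_control(2)[OF Cut(6)] in auto)
  have "Sq (Th x # Th x # entries \<gamma>) \<prec> Sq (Th x # Th x # entries \<beta>)"
    using Cut(5) prec_iff_entries[of \<gamma> \<beta>] Hop_OT[OF Cut(1)] by (simp add: seg_def)
  then have seg: "Sq (Th x # Th x # entries \<gamma>) \<in> seg (Sq (Th x # Th x # entries \<beta>))"
    using Hop_OT[OF Hop_control(1)[OF IH]] by (simp add: seg_def)
  show ?case by (rule Hop_Cut[OF _ Cut(3,4) seg IH IH2]) (use H eps in auto)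
next
  case (Fix X \<beta> \<Delta> \<phi> t \<gamma>)
  have "\<beta> \<prec> Om" using Fix.prems(1) preceq_prec_trans[of \<beta> "Th x" Om] by simp
  then show ?case using Fix(3) not_Om_le by blast
qed

text \<open>One of \<open>A\<close> and \<open>neg A\<close> is disjunctive, and
  \<open>reduction\<close> works along its derivation. With both premises of height \<epsilon> =
  \<open>Th x\<close>, the resulting height is \<epsilon>\<cdot>3.\<close>

lemma cut_reduction:
  assumes "sentence A" "rk A = \<rho>"
    and "deriv \<rho> (adjoin (Hop h) X) (Th x) (insert A \<Gamma>)"
      "deriv \<rho> (adjoin (Hop h) X) (Th x) (insert (neg A) \<Gamma>)"
  shows "deriv \<rho> (adjoin (Hop h) X) (Sq [Th x, Th x, Th x]) \<Gamma>"
proof -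
  obtain d f where "disj_of A d f \<or> disj_of (neg A) d f" using disj_of_exists[OF assms(1)] by blast
  then show ?thesis
  proof
    assume "disj_of A d f"
    from reduction[OF assms(3) _ subset_refl assms(4) this assms(1,2)] show ?thesis by simp
  next
    assume "disj_of (neg A) d f"
    from reduction[OF assms(4) _ subset_refl _ this] show ?thesis using assms by simp
  qed
qed

section \<open>The main induction\<close>

lemma predicative_cut_elimination:
  assumes \<eta>: "Omega_times Om \<preceq> \<eta>" and "\<alpha> \<in> OT" "\<alpha> \<prec> Om"
    and "\<rho> \<in> OT" "\<rho> \<prec> Om" "\<alpha> \<in> Hop \<eta> X" "\<beta> \<prec> Om"
    and "deriv (\<rho> \<oplus> omega_of \<alpha>) (adjoin (Hop \<eta>) X) \<beta> \<Gamma>"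
  shows "deriv \<rho> (adjoin (Hop \<eta>) X) (Th (phi_arg \<alpha> \<beta>)) \<Gamma>"
  using assms(2-)
\<comment> \<open>The base rank is generalised too, because the hypothesis for a smaller exponent
  \<open>a\<close> is used at each rank obtained from \<rho> by adding \<open>omega_of a\<close>
  repeatedly.\<close>
proof (induction arbitrary: \<rho> X \<beta> \<Gamma> rule: seg_Om_induct)
  case (less \<alpha>)
  note main_IH = less.IH and \<alpha> = less.hyps and \<rho> = less.prems(1,2)
  from less.prems(5) less.prems(3,4) show ?case
  proof (induction rule: deriv_Hop_induct)
    case (Conj X \<beta> \<Gamma> A d f \<gamma>)
    have H: "Th (phi_arg \<alpha> \<beta>) \<in> Hop \<eta> X" using Hop_phi_arg \<alpha> \<eta> Conj by blast
    show ?case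
    proof (rule Hop_Conj[OF _ Conj(3,4)])
      fix c assume c: "c \<in> seg d"
      have g: "\<gamma> c \<in> OT" "\<gamma> c \<prec> \<beta>" "\<gamma> c \<prec> Om"
        using Conj(5)[OF c] Conj.prems seg_prec_trans[of "\<gamma> c" \<beta> Om] by (auto simp: seg_def)
      have "\<alpha> \<in> Hop \<eta> (insert c X)" using Conj.prems Hop_mono[of X "insert c X" \<eta>] by blast
      then have "deriv \<rho> (adjoin (Hop \<eta>) (insert c X)) (Th (phi_arg \<alpha> (\<gamma> c))) (insert (f c) \<Gamma>)"
        using Conj.IH[OF c] g by blast
      moreover have "Th (phi_arg \<alpha> (\<gamma> c)) \<in> seg (Th (phi_arg \<alpha> \<beta>))"
        using Th_phi_arg_mono_right[OF \<alpha>(1) g(1) Hop_OT[OF Conj(1)] Conj.prems(2) g(2)]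
          phi_arg_OT[OF \<alpha> g(1,3)] unfolding seg_def by simp
      ultimately show "\<exists>\<gamma>\<in>seg (Th (phi_arg \<alpha> \<beta>)).
        deriv \<rho> (adjoin (Hop \<eta>) (insert c X)) \<gamma> (insert (f c) \<Gamma>)" by blast
    qed (use H Conj(2) in auto)
  next
    case (Disj X \<beta> \<Gamma> A d f c \<gamma>)
    have H: "Th (phi_arg \<alpha> \<beta>) \<in> Hop \<eta> X" using Hop_phi_arg \<alpha> \<eta> Disj by blast
    have g: "\<gamma> \<in> OT" "\<gamma> \<prec> \<beta>" "\<gamma> \<prec> Om"
      using Disj(8) Disj.prems seg_prec_trans[of \<gamma> \<beta> Om] by (auto simp: seg_def)
    have "Th (phi_arg \<alpha> \<gamma>) \<in> seg (Th (phi_arg \<alpha> \<beta>))"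
      using Th_phi_arg_mono_right[OF \<alpha>(1) g(1) Hop_OT[OF Disj(1)] Disj.prems(2) g(2)]
        phi_arg_OT[OF \<alpha> g(1,3)] unfolding seg_def by simp
    moreover have "c \<prec> Th (phi_arg \<alpha> \<beta>)"
      using Disj(6) prec_Th_phi_arg[OF Hop_OT[OF Disj(1)] Disj.prems(2)] by (rule prec_trans)
    ultimately show ?case
      using Hop_Disj[OF _ Disj(3,4,5) _ Disj(7) _ Disj.IH] H Disj(2) Disj.prems g by blast
  next
    case (Cut X \<beta> \<Gamma> A \<gamma>)
    \<comment> \<open>\<open>E\<close> is the target height and \<epsilon> the height of both
      premises after the side induction hypothesis. Being a \<vartheta>-term, \<open>E\<close> stays
      above the heights \<epsilon>\<cdot>3 and \<epsilon> + 1 that arise below.\<close>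
    define E where "E = Th (phi_arg \<alpha> \<beta>)"
    define \<epsilon> where "\<epsilon> = Th (phi_arg \<alpha> \<gamma>)"
    have EH: "E \<in> Hop \<eta> X" unfolding E_def using Hop_phi_arg \<alpha> \<eta> Cut by blast
    have g: "\<gamma> \<in> OT" "\<gamma> \<prec> \<beta>" "\<gamma> \<prec> Om"
      using Cut(5) Cut.prems seg_prec_trans[of \<gamma> \<beta> Om] by (auto simp: seg_def)
    have D: "deriv \<rho> (adjoin (Hop \<eta>) X) \<epsilon> (insert A \<Gamma>)"
      "deriv \<rho> (adjoin (Hop \<eta>) X) \<epsilon> (insert (neg A) \<Gamma>)"
      using Cut.IH Cut.prems g unfolding \<epsilon>_def by blast+
    have "\<epsilon> \<prec> E" unfolding \<epsilon>_def E_def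
      using Th_phi_arg_mono_right[OF \<alpha>(1) g(1) Hop_OT[OF Cut(1)] Cut.prems(2) g(2)] .
    have \<epsilon>H: "\<epsilon> \<in> Hop \<eta> X" "kset (insert A \<Gamma>) \<subseteq> Hop \<eta> X" using Hop_control[OF D(1)] by auto
    have raise: "deriv \<rho> (adjoin (Hop \<eta>) X) E \<Gamma>"
      if "deriv \<rho> (adjoin (Hop \<eta>) X) \<delta> \<Gamma>" "\<delta> \<prec> E" for \<delta>
      by (rule deriv_mono[OF that(1)]) (use that EH Cut(2) in auto)
    have rkA: "rk A \<in> OT" using sentence_rk_OT Cut(3) by blast
    consider "rk A \<prec> \<rho>" | "rk A = \<rho>"
      | a n where "\<not> rk A \<prec> \<rho>" "a \<in> OT" "a \<prec> \<alpha>" "Eset a \<subseteq> Eset (rk A)"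
        "rk A \<prec> ((\<lambda>x. x \<oplus> omega_of a) ^^ n) \<rho>"
      using cut_rank_split[OF \<rho>(1) rkA \<alpha>(1) Cut(4)] by blast
    then have "deriv \<rho> (adjoin (Hop \<eta>) X) E \<Gamma>"
    proof cases
      case 1
      show ?thesis
        by (rule Hop_Cut[OF _ Cut(3) 1 _ D])
          (use EH Cut(2) \<open>\<epsilon> \<prec> E\<close> Hop_OT[OF \<epsilon>H(1)] in \<open>auto simp: seg_def\<close>)
    next
      case 2
      have "deriv \<rho> (adjoin (Hop \<eta>) X) (Sq [\<epsilon>, \<epsilon>, \<epsilon>]) \<Gamma>"
        using cut_reduction[OF Cut(3) 2] D unfolding \<epsilon>_def by blast
      then show ?thesis by (rule raise) (use \<open>\<epsilon> \<prec> E\<close> in \<open>simp add: E_def\<close>)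
    next
      case (3 a n)
      let ?\<rho> = "\<lambda>k. ((\<lambda>x. x \<oplus> omega_of a) ^^ k) \<rho>"
      have "a \<prec> Om" using 3(3) \<alpha>(2) by (rule prec_trans)
      have \<rho>k: "?\<rho> k \<in> OT \<and> ?\<rho> k \<prec> Om" for k
        by (induction k) (use \<rho> 3(2) \<open>a \<prec> Om\<close> oadd_omega_of_OT oadd_omega_of_prec_Om in auto)
      \<comment> \<open>The \<vartheta>-terms in \<open>a\<close> come from the rank of
        \<open>A\<close>, hence from its parameters, and these are controlled because the premise
        containing \<open>A\<close> is derived.\<close>
      have "Eset a \<subseteq> Hop \<eta> X"
      proof
        fix e assume "e \<in> Eset a"
        then have "e \<in> \<Union> (Eset ` snd ` set_fml A)"
          using 3(4) Eset_rk[of A] Cut(3) unfolding sentence_def by fastforce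
        then show "e \<in> Hop \<eta> X" using \<epsilon>H(2) Hop_Eset by auto
      qed
      then have aH: "a \<in> Hop \<eta> X" using 3(2) Hop_of_Eset by blast
      \<comment> \<open>Each round removes one summand \<open>omega_of a\<close> from the cut rank
        by the main induction hypothesis, while \<open>Th_phi_arg_mono_left\<close> keeps the height
        below \<open>E\<close>.\<close>
      have step: "\<exists>\<delta>'. \<delta>' \<prec> E \<and> deriv \<rho> (adjoin (Hop \<eta>) X) \<delta>' \<Gamma>"
        if "deriv (?\<rho> k) (adjoin (Hop \<eta>) X) \<delta> \<Gamma>" "\<delta> \<prec> E" for k \<delta>
        using that
      proof (induction k arbitrary: \<delta>)
        case (Suc k)
        have \<delta>: "\<delta> \<in> OT" "\<delta> \<prec> Om"
          using Hop_OT[OF Hop_control(1)[OF Suc.prems(1)]] prec_trans[OF Suc.prems(2), of Om]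
          by (auto simp: E_def)
        have "deriv (?\<rho> k) (adjoin (Hop \<eta>) X) (Th (phi_arg a \<delta>)) \<Gamma>"
          by (rule main_IH[OF 3(2,3) _ _ aH \<delta>(2)]) (use \<rho>k[of k] Suc.prems in auto)
        moreover have "Th (phi_arg a \<delta>) \<prec> E"
          unfolding E_def by (rule Th_phi_arg_mono_left) (use 3 \<alpha> \<delta> Suc.prems in \<open>auto simp: E_def\<close>)
        ultimately show ?case by (rule Suc.IH)
      qed auto
      have le: "\<rho> \<preceq> ?\<rho> n" using 3(1,5) not_prec_iff preceq_prec_trans by blast
      \<comment> \<open>The premises are weakened to a cut rank at which a cut with \<open>A\<close>
        is permitted; \<open>step\<close> then brings the resulting derivation back to rank
        \<rho>.\<close>
      have up: "deriv (?\<rho> n) (adjoin (Hop \<eta>) X) \<epsilon> (insert A \<Gamma>)"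
        "deriv (?\<rho> n) (adjoin (Hop \<eta>) X) \<epsilon> (insert (neg A) \<Gamma>)"
        using deriv_mono[OF D(1) le subset_refl subset_refl] deriv_mono[OF D(2) le subset_refl subset_refl]
          \<epsilon>H by auto
      \<comment> \<open>This term is \<epsilon> + 1, the height of the conclusion of the
        cut.\<close>
      have \<epsilon>1: "Sq [\<epsilon>, Sq []] \<in> OT" using Hop_OT[OF \<epsilon>H(1)] by (auto simp: Sq_in_OT_iff)
      have \<epsilon>1H: "Sq [\<epsilon>, Sq []] \<in> Hop \<eta> X"
        by (rule Hop_of_Eset[OF \<epsilon>1]) (use Hop_Eset[OF \<epsilon>H(1)] in auto)
      have "deriv (?\<rho> n) (adjoin (Hop \<eta>) X) (Sq [\<epsilon>, Sq []]) \<Gamma>"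
        by (rule Hop_Cut[OF _ Cut(3) 3(5) _ up])
          (use \<epsilon>1H Cut(2) Hop_OT[OF \<epsilon>H(1)] in \<open>auto simp: seg_def \<epsilon>_def\<close>)
      moreover have "Sq [\<epsilon>, Sq []] \<prec> E" using \<open>\<epsilon> \<prec> E\<close> by (simp add: E_def)
      ultimately show ?thesis using step raise by blast
    qed
    then show ?case by (simp add: E_def)
  next
    case (Fix X \<beta> \<Gamma> \<phi> t \<gamma>)
    then show ?case using not_Om_le by blast
  qed
qed

theorem theorem7p8:
  fixes \<alpha> \<beta> \<rho> \<eta> :: oterm and X :: "oterm set" and \<Gamma> :: "idfml set"
  assumes "\<alpha> \<in> OT" "\<alpha> \<prec> Om"
    and "\<beta> \<in> OT" "\<beta> \<prec> Om"
    and "\<rho> \<in> OT" "\<rho> \<prec> Om"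
    and "X \<subseteq> OT"
    and "\<eta> \<in> OT" "Omega_times Om \<preceq> \<eta>"
    and "\<alpha> \<in> Hop \<eta> X"
    and "sequent \<Gamma>"
    and "deriv (\<rho> \<oplus> omega_of \<alpha>) (adjoin (Hop \<eta>) X) \<beta> \<Gamma>"
  shows "deriv \<rho> (adjoin (Hop \<eta>) X) (phibar \<alpha> \<beta>) \<Gamma>"
  unfolding phibar_eq[OF assms(1-4)]
  by (rule predicative_cut_elimination[OF assms(9,1,2,5,6,10,4,12)])

end
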